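(* Let $\mathcal{A}$ be any complete Boolean algebra. Then all the axioms (hence all the theorems) of $\mathbf{ZFC}$, when restricted to the pure $\mathbf{ZF}$-language $\mathcal{L}_p(\mathcal{T}_{\mathcal{A}})$ (with negation written $\sim$, membership written $\epsilon$ and equality written $\approx$), are valid in $\mathbf{V}^{\mathcal{T}_{\mathcal{A}}}$.
   Context: Let $\mathcal{A}=\langle A,\wedge,\vee,\to,\sim,0,1\rangle$ be a complete Boolean algebra. Its twist domain is $T_{\mathcal{A}}=\{(z_1,z_2)\in A\times A : z_1\vee z_2=1\}$. The twist structure $\mathcal{T}_{\mathcal{A}}$ is $T_{\mathcal{A}}$ with the operations $(z_1,z_2)\tilde\wedge(w_1,w_2)=(z_1\wedge w_1,z_2\vee w_2)$; $(z_1,z_2)\tilde\vee(w_1,w_2)=(z_1\vee w_1,z_2\wedge w_2)$; $(z_1,z_2)\tilde\to(w_1,w_2)=(z_1\to w_1,z_1\wedge w_2)$; $\tilde\sim(z_1,z_2)=(\sim z_1,z_1)$; $\tilde\neg(z_1,z_2)=(z_2,z_1)$. For $z\in T_{\mathcal{A}}$, $(z)_1,(z)_2$ (or $z_1,z_2$) denote its coordinates. $T_{\mathcal{A}}$ is a complete lattice with order $z\le w$ iff $z_1\le w_1$ and $z_2\ge w_2$, so $\bigwedge_i z_i=(\bigwedge_i (z_i)_1,\bigvee_i (z_i)_2)$ and $\bigvee_i z_i=(\bigvee_i (z_i)_1,\bigwedge_i (z_i)_2)$. The set of designated values is $D_{\mathcal{A}}=\{(1,a): a\in A\}$. By transfinite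 recursion, $\mathbf{V}^{\mathcal{T}_{\mathcal{A}}}_\alpha=\{x : x$ is a function, $ran(x)\subseteq T_{\mathcal{A}}$ and $dom(x)\subseteq \mathbf{V}^{\mathcal{T}_{\mathcal{A}}}_\xi$ for some $\xi<\alpha\}$, and $\mathbf{V}^{\mathcal{T}_{\mathcal{A}}}=\bigcup_\alpha \mathbf{V}^{\mathcal{T}_{\mathcal{A}}}_\alpha$ (a proper class), the twist-valued model over $\mathcal{A}$. $\mathcal{L}$ is the first-order language with binary predicates $\epsilon$ (membership) and $\approx$ (identity), connectives $\wedge,\vee,\to,\sim,\neg$ ($\sim$ is the strong, classical negation; $\neg$ the paraconsistent one) and quantifiers $\forall,\exists$. $\mathcal{L}(\mathcal{T}_{\mathcal{A}})$ adds to $\mathcal{L}$ a constant for each $u\in\mathbf{V}^{\mathcal{T}_{\mathcal{A}}}$ (identified with $u$). $\mathcal{L}_p(\mathcal{T}_{\mathcal{A}})$ (pure $\mathbf{ZF}$-language) is the fragment of $\mathcal{L}(\mathcal{T}_{\mathcal{A}})$ without $\neg$. Each sentence of $\mathcal{L}(\mathcal{T}_{\mathcal{A}})$ gets a value in $T_{\mathcal{A}}$ by: $\lbrack\!\lbrack u\,\epsilon\, v\rbrack\!\rbrack=\bigvee_{x\in dom(v)}(v(x)\,\tilde\wedge\,\lbrack\!\lbrack x\approx u\rbrack\!\rbrack)$; $\lbrack\!\lbrack u\approx v\rbrack\!\rbrack=\bigwedge_{x\in dom(u)}(u(x)\,\tilde\to\,\lbrack\!\lbrack x\,\epsilon\,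 v\rbrack\!\rbrack)\ \tilde\wedge\ \bigwedge_{x\in dom(v)}(v(x)\,\tilde\to\,\lbrack\!\lbrack x\,\epsilon\, u\rbrack\!\rbrack)$; $\lbrack\!\lbrack\phi\#\psi\rbrack\!\rbrack=\lbrack\!\lbrack\phi\rbrack\!\rbrack\,\tilde\#\,\lbrack\!\lbrack\psi\rbrack\!\rbrack$ for $\#\in\{\wedge,\vee,\to\}$; $\lbrack\!\lbrack\#\psi\rbrack\!\rbrack=\tilde\#\lbrack\!\lbrack\psi\rbrack\!\rbrack$ for $\#\in\{\sim,\neg\}$; $\lbrack\!\lbrack\forall x\varphi(x)\rbrack\!\rbrack=\bigwedge_{u\in\mathbf{V}^{\mathcal{T}_{\mathcal{A}}}}\lbrack\!\lbrack\varphi(u)\rbrack\!\rbrack$; $\lbrack\!\lbrack\exists x\varphi(x)\rbrack\!\rbrack=\bigvee_{u\in\mathbf{V}^{\mathcal{T}_{\mathcal{A}}}}\lbrack\!\lbrack\varphi(u)\rbrack\!\rbrack$. A sentence $\varphi$ is valid in $\mathbf{V}^{\mathcal{T}_{\mathcal{A}}}$, written $\mathbf{V}^{\mathcal{T}_{\mathcal{A}}}\models\varphi$, if $\lbrack\!\lbrack\varphi\rbrack\!\rbrack\in D_{\mathcal{A}}$. A formula with free variables is valid if it is so under every assignment of elements of $\mathbf{V}^{\mathcal{T}_{\mathcal{A}}}$ to its free variables. *)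

theory Defs
  imports "HOL-Library.Multiset"
begin

section \<open>The ambient universe of sets\<close>

text \<open>
  The twist-valued model is a proper class of the set-theoretic metatheory. Here the metatheoretic
  universe is a type of class \<open>zfc_universe\<close>: all its elements are sets, and \<open>elts x\<close> is the
  HOL set of members of \<open>x\<close>. A HOL set of elements of that type is a class of the metatheory; it
  "is a set" iff it is \<open>elts x\<close> for some \<open>x\<close>. Separation and replacement hold for
  arbitrary HOL predicates and functions, and the axiom of choice is inherited from HOL.
  HOL cannot prove that the class has an instance: this would yield the consistency of ZFC.
\<close>

class zfc_universe =
  fixes elts :: "'a \<Rightarrow> 'a set"
  assumes extensionality: "elts x = elts y \<Longrightarrow> x = y"
    and foundation: "wf {(x, y). x \<in> elts y}"
    and separation: "\<exists>b. elts b = {x \<in> elts a. P x}"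
    and pairing: "\<exists>c. elts c = {a, b}"
    and union: "\<exists>b. elts b = (\<Union>x \<in> elts a. elts x)"
    and powerset: "\<exists>b. elts b = {x. elts x \<subseteq> elts a}"
    and infinity: "\<exists>a. (\<exists>z \<in> elts a. elts z = {}) \<and>
                       (\<forall>x \<in> elts a. \<exists>y \<in> elts a. elts y = insert x (elts x))"
    and replacement: "\<exists>b. elts b = f ` elts a"

definition vset :: "'v::zfc_universe set \<Rightarrow> 'v" where
  "vset X = (THE v. elts v = X)"

definition vpair :: "'v::zfc_universe \<Rightarrow> 'v \<Rightarrow> 'v" where
  "vpair x y = vset {vset {x}, vset {x, y}}"

definition is_function :: "'v::zfc_universe \<Rightarrow> bool" where
  "is_function f \<longleftrightarrow>
     (\<forall>p \<in> elts f. \<exists>x y. p = vpair x y) \<and>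
     (\<forall>x y y'. vpair x y \<in> elts f \<and> vpair x y' \<in> elts f \<longrightarrow> y = y')"

definition vdom :: "'v::zfc_universe \<Rightarrow> 'v set" where
  "vdom f = {x. \<exists>y. vpair x y \<in> elts f}"

definition vran :: "'v::zfc_universe \<Rightarrow> 'v set" where
  "vran f = {y. \<exists>x. vpair x y \<in> elts f}"

definition is_ordinal :: "'v::zfc_universe \<Rightarrow> bool" where
  "is_ordinal \<alpha> \<longleftrightarrow>
     (\<forall>\<xi> \<in> elts \<alpha>. elts \<xi> \<subseteq> elts \<alpha>) \<and>
     (\<forall>\<xi> \<in> elts \<alpha>. \<forall>\<eta> \<in> elts \<xi>. elts \<eta> \<subseteq> elts \<xi>)"


section \<open>The twist structure over a complete Boolean algebra\<close>

text \<open>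
  Complete Boolean algebras are the types of sort \<open>{complete_lattice, boolean_algebra}\<close>.
  The library class \<open>complete_boolean_algebra\<close> is not suitable: it additionally demands complete
  distributivity, i.e. atomicity.
\<close>

type_synonym 'a twist = "'a \<times> 'a"

definition twist_domain :: "'a::{complete_lattice, boolean_algebra} twist set" where
  "twist_domain = {(z1, z2). sup z1 z2 = top}"

fun twist_and :: "'a::{complete_lattice, boolean_algebra} twist \<Rightarrow> 'a twist \<Rightarrow> 'a twist" where
  "twist_and (z1, z2) (w1, w2) = (inf z1 w1, sup z2 w2)"

fun twist_or :: "'a::{complete_lattice, boolean_algebra} twist \<Rightarrow> 'a twist \<Rightarrow> 'a twist" where
  "twist_or (z1, z2) (w1, w2) = (sup z1 w1, inf z2 w2)"

fun twist_imp :: "'a::{complete_lattice, boolean_algebra} twist \<Rightarrow> 'a twist \<Rightarrow> 'a twist" where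
  "twist_imp (z1, z2) (w1, w2) = (sup (- z1) w1, inf z1 w2)"

fun twist_snot :: "'a::{complete_lattice, boolean_algebra} twist \<Rightarrow> 'a twist" where
  "twist_snot (z1, z2) = (- z1, z1)"

fun twist_pnot :: "'a::{complete_lattice, boolean_algebra} twist \<Rightarrow> 'a twist" where
  "twist_pnot (z1, z2) = (z2, z1)"

definition twist_Inf :: "'a::{complete_lattice, boolean_algebra} twist set \<Rightarrow> 'a twist" where
  "twist_Inf Z = (Inf (fst ` Z), Sup (snd ` Z))"

definition twist_Sup :: "'a::{complete_lattice, boolean_algebra} twist set \<Rightarrow> 'a twist" where
  "twist_Sup Z = (Sup (fst ` Z), Inf (snd ` Z))"

definition designated :: "'a::{complete_lattice, boolean_algebra} twist set" where
  "designated = {(top, a) | a. True}"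


section \<open>The twist-valued model\<close>

text \<open>
  The Boolean algebra has to be a set of the universe. This is expressed by an injection
  \<open>code\<close> of the type \<open>'a\<close> into the universe whose range is a set; \<open>twist_code code\<close>
  is then the element of the universe representing a pair of elements of the algebra.
\<close>

fun twist_code :: "('a \<Rightarrow> 'v::zfc_universe) \<Rightarrow> 'a twist \<Rightarrow> 'v" where
  "twist_code code (z1, z2) = vpair (code z1) (code z2)"

function V_level :: "('a::{complete_lattice, boolean_algebra} \<Rightarrow> 'v::zfc_universe) \<Rightarrow> 'v \<Rightarrow> 'v set" where
  "V_level code \<alpha> =
     {x. is_function x \<and> vran x \<subseteq> twist_code code ` twist_domain \<and>
         (\<exists>\<xi> \<in> elts \<alpha>. vdom x \<subseteq> V_level code \<xi>)}"
  by auto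
termination
  by (relation "inv_image {(x, y). x \<in> elts y} snd") (auto simp: foundation)

declare V_level.simps [simp del]

definition V_twist :: "('a::{complete_lattice, boolean_algebra} \<Rightarrow> 'v::zfc_universe) \<Rightarrow> 'v set" where
  "V_twist code = (\<Union>\<alpha> \<in> {\<alpha>. is_ordinal \<alpha>}. V_level code \<alpha>)"

definition twist_app ::
  "('a::{complete_lattice, boolean_algebra} \<Rightarrow> 'v::zfc_universe) \<Rightarrow> 'v \<Rightarrow> 'v \<Rightarrow> 'a twist" where
  "twist_app code u x = (THE z. vpair x (twist_code code z) \<in> elts u)"

lemma elts_vset: "elts b = X \<Longrightarrow> elts (vset X) = X"
  unfolding vset_def by (rule theI2[where a = b]) (auto intro: extensionality)

lemma elts_vset_pair: "elts (vset {x, y}) = {x, y}"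
  using pairing[of x y] elts_vset by metis

lemma vdom_trancl:
  assumes "x \<in> vdom u"
  shows "(x, u) \<in> {(x, y). x \<in> elts y}\<^sup>+"
proof -
  obtain y where "vpair x y \<in> elts u"
    using assms by (auto simp: vdom_def)
  moreover have "vset {x} \<in> elts (vpair x y)"
    unfolding vpair_def elts_vset_pair by simp
  moreover have "x \<in> elts (vset {x})"
    using elts_vset_pair[of x x] by simp
  ultimately have "(x, vset {x}) \<in> {(x, y). x \<in> elts y}"
    "(vset {x}, vpair x y) \<in> {(x, y). x \<in> elts y}" "(vpair x y, u) \<in> {(x, y). x \<in> elts y}"
    by auto
  then show ?thesis
    by (meson r_into_trancl trancl_trans)
qed

lemma mult_vdom:
  fixes u v x :: "'v::zfc_universe"
  assumes "x \<in> vdom v"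
  shows "({#x, u#}, {#u, v#}) \<in> mult ({(x, y). x \<in> elts y}\<^sup>+)"
    "({#x, u#}, {#v, u#}) \<in> mult ({(x, y). x \<in> elts y}\<^sup>+)"
    "({#u, x#}, {#u, v#}) \<in> mult ({(x, y). x \<in> elts y}\<^sup>+)"
    "({#u, x#}, {#v, u#}) \<in> mult ({(x, y). x \<in> elts y}\<^sup>+)"
  using one_step_implies_mult[of "{#v#}" "{#x#}" "{(x, y). x \<in> elts y}\<^sup>+" "{#u#}"] vdom_trancl[OF assms]
  by (simp_all add: add_mset_commute)

function (sequential)
  val_mem :: "('a::{complete_lattice, boolean_algebra} \<Rightarrow> 'v::zfc_universe) \<Rightarrow> 'v \<Rightarrow> 'v \<Rightarrow> 'a twist" and
  val_eq :: "('a::{complete_lattice, boolean_algebra} \<Rightarrow> 'v::zfc_universe) \<Rightarrow> 'v \<Rightarrow> 'v \<Rightarrow> 'a twist"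
where
  "val_mem code u v =
     twist_Sup ((\<lambda>x. twist_and (twist_app code v x) (val_eq code x u)) ` vdom v)"
| "val_eq code u v =
     twist_and
       (twist_Inf ((\<lambda>x. twist_imp (twist_app code u x) (val_mem code x v)) ` vdom u))
       (twist_Inf ((\<lambda>x. twist_imp (twist_app code v x) (val_mem code x u)) ` vdom v))"
  by pat_completeness auto
termination
  by (relation "inv_image (mult ({(x, y). x \<in> elts y}\<^sup>+))
        (case_sum (\<lambda>(code, u, v). {#u, v#}) (\<lambda>(code, u, v). {#u, v#}))")
     (auto intro!: wf_mult wf_trancl foundation intro: mult_vdom)

declare val_mem.simps [simp del] val_eq.simps [simp del]


section \<open>The language\<close>

datatype 'c trm = Var nat | Cst 'c

datatype 'c form =
    Mem "'c trm" "'c trm"  (infix "\<^bold>\<in>" 70)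
  | Eq "'c trm" "'c trm"  (infix "\<^bold>\<approx>" 70)
  | And "'c form" "'c form"  (infixr "\<^bold>\<and>" 60)
  | Or "'c form" "'c form"  (infixr "\<^bold>\<or>" 55)
  | Imp "'c form" "'c form"  (infixr "\<^bold>\<longrightarrow>" 50)
  | SNot "'c form"  ("\<^bold>\<sim> _" [65] 65)
  | PNot "'c form"  ("\<^bold>\<not> _" [65] 65)
  | All nat "'c form"  ("(3\<^bold>\<forall>_./ _)" [0, 45] 45)
  | Ex nat "'c form"  ("(3\<^bold>\<exists>_./ _)" [0, 45] 45)

abbreviation Iff :: "'c form \<Rightarrow> 'c form \<Rightarrow> 'c form"  (infix "\<^bold>\<longleftrightarrow>" 48) where
  "\<phi> \<^bold>\<longleftrightarrow> \<psi> \<equiv> (\<phi> \<^bold>\<longrightarrow> \<psi>) \<^bold>\<and> (\<psi> \<^bold>\<longrightarrow> \<phi>)"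

text \<open>Unique existence in \<open>x\<close>; \<open>w\<close> is an auxiliary variable that must be fresh.\<close>

abbreviation Ex1 :: "nat \<Rightarrow> nat \<Rightarrow> 'c form \<Rightarrow> 'c form" where
  "Ex1 w x \<phi> \<equiv> \<^bold>\<exists>w. \<^bold>\<forall>x. (\<phi> \<^bold>\<longleftrightarrow> Var x \<^bold>\<approx> Var w)"

primrec trm_lang :: "'c set \<Rightarrow> 'c trm \<Rightarrow> bool" where
  "trm_lang C (Var x) \<longleftrightarrow> True"
| "trm_lang C (Cst c) \<longleftrightarrow> c \<in> C"

text \<open>Formulas of the pure ZF-language with constants from \<open>C\<close>.\<close>

primrec pure_lang :: "'c set \<Rightarrow> 'c form \<Rightarrow> bool" where
  "pure_lang C (s \<^bold>\<in> t) \<longleftrightarrow> trm_lang C s \<and> trm_lang C t"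
| "pure_lang C (s \<^bold>\<approx> t) \<longleftrightarrow> trm_lang C s \<and> trm_lang C t"
| "pure_lang C (\<phi> \<^bold>\<and> \<psi>) \<longleftrightarrow> pure_lang C \<phi> \<and> pure_lang C \<psi>"
| "pure_lang C (\<phi> \<^bold>\<or> \<psi>) \<longleftrightarrow> pure_lang C \<phi> \<and> pure_lang C \<psi>"
| "pure_lang C (\<phi> \<^bold>\<longrightarrow> \<psi>) \<longleftrightarrow> pure_lang C \<phi> \<and> pure_lang C \<psi>"
| "pure_lang C (\<^bold>\<sim> \<phi>) \<longleftrightarrow> pure_lang C \<phi>"
| "pure_lang C (\<^bold>\<not> \<phi>) \<longleftrightarrow> False"
| "pure_lang C (\<^bold>\<forall>x. \<phi>) \<longleftrightarrow> pure_lang C \<phi>"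
| "pure_lang C (\<^bold>\<exists>x. \<phi>) \<longleftrightarrow> pure_lang C \<phi>"

primrec fv_trm :: "'c trm \<Rightarrow> nat set" where
  "fv_trm (Var x) = {x}"
| "fv_trm (Cst c) = {}"

primrec fv :: "'c form \<Rightarrow> nat set" where
  "fv (s \<^bold>\<in> t) = fv_trm s \<union> fv_trm t"
| "fv (s \<^bold>\<approx> t) = fv_trm s \<union> fv_trm t"
| "fv (\<phi> \<^bold>\<and> \<psi>) = fv \<phi> \<union> fv \<psi>"
| "fv (\<phi> \<^bold>\<or> \<psi>) = fv \<phi> \<union> fv \<psi>"
| "fv (\<phi> \<^bold>\<longrightarrow> \<psi>) = fv \<phi> \<union> fv \<psi>"
| "fv (\<^bold>\<sim> \<phi>) = fv \<phi>"
| "fv (\<^bold>\<not> \<phi>) = fv \<phi>"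
| "fv (\<^bold>\<forall>x. \<phi>) = fv \<phi> - {x}"
| "fv (\<^bold>\<exists>x. \<phi>) = fv \<phi> - {x}"

primrec subst_trm :: "nat \<Rightarrow> 'c trm \<Rightarrow> 'c trm \<Rightarrow> 'c trm" where
  "subst_trm x t (Var y) = (if y = x then t else Var y)"
| "subst_trm x t (Cst c) = Cst c"

text \<open>\<open>subst x t \<phi>\<close> replaces the free occurrences of \<open>x\<close> by \<open>t\<close>; it is only
  meaningful when \<open>free_for x t \<phi>\<close> holds, as bound variables are not renamed.\<close>

primrec subst :: "nat \<Rightarrow> 'c trm \<Rightarrow> 'c form \<Rightarrow> 'c form" where
  "subst x t (r \<^bold>\<in> s) = (subst_trm x t r \<^bold>\<in> subst_trm x t s)"
| "subst x t (r \<^bold>\<approx> s) = (subst_trm x t r \<^bold>\<approx> subst_trm x t s)"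
| "subst x t (\<phi> \<^bold>\<and> \<psi>) = (subst x t \<phi> \<^bold>\<and> subst x t \<psi>)"
| "subst x t (\<phi> \<^bold>\<or> \<psi>) = (subst x t \<phi> \<^bold>\<or> subst x t \<psi>)"
| "subst x t (\<phi> \<^bold>\<longrightarrow> \<psi>) = (subst x t \<phi> \<^bold>\<longrightarrow> subst x t \<psi>)"
| "subst x t (\<^bold>\<sim> \<phi>) = (\<^bold>\<sim> subst x t \<phi>)"
| "subst x t (\<^bold>\<not> \<phi>) = (\<^bold>\<not> subst x t \<phi>)"
| "subst x t (\<^bold>\<forall>y. \<phi>) = (\<^bold>\<forall>y. (if y = x then \<phi> else subst x t \<phi>))"
| "subst x t (\<^bold>\<exists>y. \<phi>) = (\<^bold>\<exists>y. (if y = x then \<phi> else subst x t \<phi>))"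

primrec free_for :: "nat \<Rightarrow> 'c trm \<Rightarrow> 'c form \<Rightarrow> bool" where
  "free_for x t (r \<^bold>\<in> s) \<longleftrightarrow> True"
| "free_for x t (r \<^bold>\<approx> s) \<longleftrightarrow> True"
| "free_for x t (\<phi> \<^bold>\<and> \<psi>) \<longleftrightarrow> free_for x t \<phi> \<and> free_for x t \<psi>"
| "free_for x t (\<phi> \<^bold>\<or> \<psi>) \<longleftrightarrow> free_for x t \<phi> \<and> free_for x t \<psi>"
| "free_for x t (\<phi> \<^bold>\<longrightarrow> \<psi>) \<longleftrightarrow> free_for x t \<phi> \<and> free_for x t \<psi>"
| "free_for x t (\<^bold>\<sim> \<phi>) \<longleftrightarrow> free_for x t \<phi>"
| "free_for x t (\<^bold>\<not> \<phi>) \<longleftrightarrow> free_for x t \<phi>"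
| "free_for x t (\<^bold>\<forall>y. \<phi>) \<longleftrightarrow> x \<notin> fv (\<^bold>\<forall>y. \<phi>) \<or> (y \<notin> fv_trm t \<and> free_for x t \<phi>)"
| "free_for x t (\<^bold>\<exists>y. \<phi>) \<longleftrightarrow> x \<notin> fv (\<^bold>\<exists>y. \<phi>) \<or> (y \<notin> fv_trm t \<and> free_for x t \<phi>)"


section \<open>Truth values and validity\<close>

text \<open>Constants denote themselves; free variables are interpreted by the assignment \<open>e\<close>.\<close>

primrec val_trm :: "(nat \<Rightarrow> 'v) \<Rightarrow> 'v trm \<Rightarrow> 'v" where
  "val_trm e (Var x) = e x"
| "val_trm e (Cst u) = u"

primrec val :: "('a::{complete_lattice, boolean_algebra} \<Rightarrow> 'v::zfc_universe) \<Rightarrow>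
    (nat \<Rightarrow> 'v) \<Rightarrow> 'v form \<Rightarrow> 'a twist" where
  "val code e (s \<^bold>\<in> t) = val_mem code (val_trm e s) (val_trm e t)"
| "val code e (s \<^bold>\<approx> t) = val_eq code (val_trm e s) (val_trm e t)"
| "val code e (\<phi> \<^bold>\<and> \<psi>) = twist_and (val code e \<phi>) (val code e \<psi>)"
| "val code e (\<phi> \<^bold>\<or> \<psi>) = twist_or (val code e \<phi>) (val code e \<psi>)"
| "val code e (\<phi> \<^bold>\<longrightarrow> \<psi>) = twist_imp (val code e \<phi>) (val code e \<psi>)"
| "val code e (\<^bold>\<sim> \<phi>) = twist_snot (val code e \<phi>)"
| "val code e (\<^bold>\<not> \<phi>) = twist_pnot (val code e \<phi>)"
| "val code e (\<^bold>\<forall>x. \<phi>) = twist_Inf ((\<lambda>u. val code (e(x := u)) \<phi>) ` V_twist code)"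
| "val code e (\<^bold>\<exists>x. \<phi>) = twist_Sup ((\<lambda>u. val code (e(x := u)) \<phi>) ` V_twist code)"

definition valid :: "('a::{complete_lattice, boolean_algebra} \<Rightarrow> 'v::zfc_universe) \<Rightarrow>
    'v form \<Rightarrow> bool" where
  "valid code \<phi> \<longleftrightarrow> (\<forall>e. (\<forall>x. e x \<in> V_twist code) \<longrightarrow> val code e \<phi> \<in> designated)"


section \<open>ZFC in the pure language\<close>

text \<open>
  The axioms are given with arbitrary (distinct) variable names. In the two schemas \<open>\<phi>\<close> ranges
  over the pure formulas; its remaining free variables and its constants act as parameters.
\<close>

inductive zfc_axiom :: "'c set \<Rightarrow> 'c form \<Rightarrow> bool" for C where
  ax_extensionality: "distinct [x, y, z] \<Longrightarrow>
    zfc_axiom C (\<^bold>\<forall>x. \<^bold>\<forall>y. ((\<^bold>\<forall>z. (Var z \<^bold>\<in> Var x \<^bold>\<longleftrightarrow> Var z \<^bold>\<in> Var y)) \<^bold>\<longrightarrow> Var x \<^bold>\<approx> Var y))"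
| ax_foundation: "distinct [x, y, z] \<Longrightarrow>
    zfc_axiom C (\<^bold>\<forall>x. ((\<^bold>\<exists>y. Var y \<^bold>\<in> Var x) \<^bold>\<longrightarrow>
      (\<^bold>\<exists>y. (Var y \<^bold>\<in> Var x \<^bold>\<and> \<^bold>\<sim> (\<^bold>\<exists>z. (Var z \<^bold>\<in> Var x \<^bold>\<and> Var z \<^bold>\<in> Var y))))))"
| ax_separation: "pure_lang C \<phi> \<Longrightarrow> distinct [a, b, x] \<Longrightarrow> b \<notin> fv \<phi> \<Longrightarrow>
    zfc_axiom C (\<^bold>\<forall>a. \<^bold>\<exists>b. \<^bold>\<forall>x. (Var x \<^bold>\<in> Var b \<^bold>\<longleftrightarrow> Var x \<^bold>\<in> Var a \<^bold>\<and> \<phi>))"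
| ax_pairing: "distinct [x, y, z, w] \<Longrightarrow>
    zfc_axiom C (\<^bold>\<forall>x. \<^bold>\<forall>y. \<^bold>\<exists>z. \<^bold>\<forall>w. (Var w \<^bold>\<in> Var z \<^bold>\<longleftrightarrow> Var w \<^bold>\<approx> Var x \<^bold>\<or> Var w \<^bold>\<approx> Var y))"
| ax_union: "distinct [a, b, x, y] \<Longrightarrow>
    zfc_axiom C (\<^bold>\<forall>a. \<^bold>\<exists>b. \<^bold>\<forall>x. (Var x \<^bold>\<in> Var b \<^bold>\<longleftrightarrow> (\<^bold>\<exists>y. (Var y \<^bold>\<in> Var a \<^bold>\<and> Var x \<^bold>\<in> Var y))))"
| ax_powerset: "distinct [a, b, x, y] \<Longrightarrow>
    zfc_axiom C (\<^bold>\<forall>a. \<^bold>\<exists>b. \<^bold>\<forall>x.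
      (Var x \<^bold>\<in> Var b \<^bold>\<longleftrightarrow> (\<^bold>\<forall>y. (Var y \<^bold>\<in> Var x \<^bold>\<longrightarrow> Var y \<^bold>\<in> Var a))))"
| ax_infinity: "distinct [a, x, y, z] \<Longrightarrow>
    zfc_axiom C (\<^bold>\<exists>a. ((\<^bold>\<exists>x. (Var x \<^bold>\<in> Var a \<^bold>\<and> (\<^bold>\<forall>z. \<^bold>\<sim> (Var z \<^bold>\<in> Var x)))) \<^bold>\<and>
      (\<^bold>\<forall>x. (Var x \<^bold>\<in> Var a \<^bold>\<longrightarrow>
        (\<^bold>\<exists>y. (Var y \<^bold>\<in> Var a \<^bold>\<and> (\<^bold>\<forall>z. (Var z \<^bold>\<in> Var y \<^bold>\<longleftrightarrow> Var z \<^bold>\<in> Var x \<^bold>\<or> Var z \<^bold>\<approx> Var x))))))))"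
| ax_replacement: "pure_lang C \<phi> \<Longrightarrow> distinct [a, b, x, y, w] \<Longrightarrow> b \<notin> fv \<phi> \<Longrightarrow> w \<notin> fv \<phi> \<Longrightarrow>
    zfc_axiom C (\<^bold>\<forall>a. ((\<^bold>\<forall>x. (Var x \<^bold>\<in> Var a \<^bold>\<longrightarrow> Ex1 w y \<phi>)) \<^bold>\<longrightarrow>
      (\<^bold>\<exists>b. \<^bold>\<forall>y. (Var y \<^bold>\<in> Var b \<^bold>\<longleftrightarrow> (\<^bold>\<exists>x. (Var x \<^bold>\<in> Var a \<^bold>\<and> \<phi>))))))"
| ax_choice: "distinct [a, c, x, y, z, w] \<Longrightarrow>
    zfc_axiom C (\<^bold>\<forall>a.
      ((\<^bold>\<forall>x. (Var x \<^bold>\<in> Var a \<^bold>\<longrightarrow> (\<^bold>\<exists>y. Var y \<^bold>\<in> Var x))) \<^bold>\<and>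
       (\<^bold>\<forall>x. \<^bold>\<forall>y. (Var x \<^bold>\<in> Var a \<^bold>\<and> Var y \<^bold>\<in> Var a \<^bold>\<and> (\<^bold>\<exists>z. (Var z \<^bold>\<in> Var x \<^bold>\<and> Var z \<^bold>\<in> Var y)) \<^bold>\<longrightarrow>
          Var x \<^bold>\<approx> Var y)) \<^bold>\<longrightarrow>
       (\<^bold>\<exists>c. \<^bold>\<forall>x. (Var x \<^bold>\<in> Var a \<^bold>\<longrightarrow> Ex1 w y (Var y \<^bold>\<in> Var x \<^bold>\<and> Var y \<^bold>\<in> Var c)))))"

text \<open>Derivability from ZFC in classical first-order logic with identity (a Hilbert calculus).\<close>

inductive zfc_theorem :: "'c set \<Rightarrow> 'c form \<Rightarrow> bool" for C where
  zfc: "zfc_axiom C \<phi> \<Longrightarrow> zfc_theorem C \<phi>"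
| imp_weaken: "pure_lang C (\<phi> \<^bold>\<longrightarrow> \<psi>) \<Longrightarrow> zfc_theorem C (\<phi> \<^bold>\<longrightarrow> \<psi> \<^bold>\<longrightarrow> \<phi>)"
| imp_distrib: "pure_lang C (\<phi> \<^bold>\<longrightarrow> \<psi> \<^bold>\<longrightarrow> \<chi>) \<Longrightarrow>
    zfc_theorem C ((\<phi> \<^bold>\<longrightarrow> \<psi> \<^bold>\<longrightarrow> \<chi>) \<^bold>\<longrightarrow> (\<phi> \<^bold>\<longrightarrow> \<psi>) \<^bold>\<longrightarrow> \<phi> \<^bold>\<longrightarrow> \<chi>)"
| and_elim1: "pure_lang C (\<phi> \<^bold>\<and> \<psi>) \<Longrightarrow> zfc_theorem C (\<phi> \<^bold>\<and> \<psi> \<^bold>\<longrightarrow> \<phi>)"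
| and_elim2: "pure_lang C (\<phi> \<^bold>\<and> \<psi>) \<Longrightarrow> zfc_theorem C (\<phi> \<^bold>\<and> \<psi> \<^bold>\<longrightarrow> \<psi>)"
| and_intro: "pure_lang C (\<phi> \<^bold>\<and> \<psi>) \<Longrightarrow> zfc_theorem C (\<phi> \<^bold>\<longrightarrow> \<psi> \<^bold>\<longrightarrow> \<phi> \<^bold>\<and> \<psi>)"
| or_intro1: "pure_lang C (\<phi> \<^bold>\<or> \<psi>) \<Longrightarrow> zfc_theorem C (\<phi> \<^bold>\<longrightarrow> \<phi> \<^bold>\<or> \<psi>)"
| or_intro2: "pure_lang C (\<phi> \<^bold>\<or> \<psi>) \<Longrightarrow> zfc_theorem C (\<psi> \<^bold>\<longrightarrow> \<phi> \<^bold>\<or> \<psi>)"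
| or_elim: "pure_lang C (\<phi> \<^bold>\<or> \<psi> \<^bold>\<longrightarrow> \<chi>) \<Longrightarrow>
    zfc_theorem C ((\<phi> \<^bold>\<longrightarrow> \<chi>) \<^bold>\<longrightarrow> (\<psi> \<^bold>\<longrightarrow> \<chi>) \<^bold>\<longrightarrow> \<phi> \<^bold>\<or> \<psi> \<^bold>\<longrightarrow> \<chi>)"
| not_intro: "pure_lang C (\<phi> \<^bold>\<longrightarrow> \<psi>) \<Longrightarrow>
    zfc_theorem C ((\<phi> \<^bold>\<longrightarrow> \<psi>) \<^bold>\<longrightarrow> (\<phi> \<^bold>\<longrightarrow> \<^bold>\<sim> \<psi>) \<^bold>\<longrightarrow> \<^bold>\<sim> \<phi>)"
| not_not: "pure_lang C \<phi> \<Longrightarrow> zfc_theorem C (\<^bold>\<sim> (\<^bold>\<sim> \<phi>) \<^bold>\<longrightarrow> \<phi>)"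
| all_elim: "pure_lang C \<phi> \<Longrightarrow> trm_lang C t \<Longrightarrow> free_for x t \<phi> \<Longrightarrow>
    zfc_theorem C ((\<^bold>\<forall>x. \<phi>) \<^bold>\<longrightarrow> subst x t \<phi>)"
| ex_intro: "pure_lang C \<phi> \<Longrightarrow> trm_lang C t \<Longrightarrow> free_for x t \<phi> \<Longrightarrow>
    zfc_theorem C (subst x t \<phi> \<^bold>\<longrightarrow> (\<^bold>\<exists>x. \<phi>))"
| eq_refl: "trm_lang C t \<Longrightarrow> zfc_theorem C (t \<^bold>\<approx> t)"
| eq_subst: "pure_lang C \<phi> \<Longrightarrow> trm_lang C s \<Longrightarrow> trm_lang C t \<Longrightarrow> free_for x s \<phi> \<Longrightarrow> free_for x t \<phi> \<Longrightarrow>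
    zfc_theorem C (s \<^bold>\<approx> t \<^bold>\<longrightarrow> subst x s \<phi> \<^bold>\<longrightarrow> subst x t \<phi>)"
| modus_ponens: "zfc_theorem C (\<phi> \<^bold>\<longrightarrow> \<psi>) \<Longrightarrow> zfc_theorem C \<phi> \<Longrightarrow> zfc_theorem C \<psi>"
| all_intro: "zfc_theorem C (\<psi> \<^bold>\<longrightarrow> \<phi>) \<Longrightarrow> x \<notin> fv \<psi> \<Longrightarrow> zfc_theorem C (\<psi> \<^bold>\<longrightarrow> (\<^bold>\<forall>x. \<phi>))"
| ex_elim: "zfc_theorem C (\<phi> \<^bold>\<longrightarrow> \<psi>) \<Longrightarrow> x \<notin> fv \<psi> \<Longrightarrow> zfc_theorem C ((\<^bold>\<exists>x. \<phi>) \<^bold>\<longrightarrow> \<psi>)"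

end

theory Submission
  imports Defs
begin

text \<open>
  A sentence is valid as soon as the first coordinate of its value is \<open>top\<close>, and the first
  coordinates of \<open>twist_and\<close>, \<open>twist_or\<close>, \<open>twist_imp\<close>, \<open>twist_snot\<close>,
  \<open>twist_Inf\<close> and \<open>twist_Sup\<close> are the Boolean operations on first coordinates. Only
  the paraconsistent negation reads a second coordinate. Hence on pure formulas the first coordinate
  of the value is the truth value in a Boolean-valued model of the usual Scott--Solovay kind, whose
  names are the elements of \<open>V_twist code\<close>, a name \<open>u\<close> giving to \<open>x\<close> in its
  domain the weight \<open>app u x\<close>. The theorem thus becomes the classical fact that
  Boolean-valued models satisfy ZFC.

  This fact is proved in forcing style: for \<open>p\<close> in the algebra, \<open>forces p e \<phi>\<close> says
  that \<open>p\<close> is below the truth value of \<open>\<phi>\<close>. The lattice operations then turn into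
  natural deduction rules. To force an implication is to force its conclusion at every smaller condition
  that forces its premise, and to use a disjunction or an existential below \<open>p\<close> one may pass to a
  smaller \<open>q\<close> that forces one of its cases (\<open>le_SUP_E\<close>). Validity is being forced by
  \<open>top\<close>.

  Three ingredients carry the axioms. The relations \<open>eqv\<close> and \<open>mem\<close> obey the laws of
  equality, so that truth of pure formulas is invariant under \<open>eqv\<close> (\<open>forces_eqv\<close>).
  Every weight function on a set of names is again a name (\<open>name_in_V\<close>). From these two
  follows a comprehension principle (\<open>forces_comprehension\<close>): a class defined by a pure formula
  is a set of the model if some set \<open>W\<close> of names contains, up to \<open>eqv\<close>, all its members.
  Separation, pairing, union, power set and replacement each reduce to naming \<open>W\<close>; replacement
  uses that a function into the algebra takes only a set of values (\<open>collection\<close>). Foundation is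
  induction on names, infinity is witnessed by the canonical name of an inductive set, and choice comes
  from a well-order of the names, which selects a first element of each set of the family
  (\<open>selector\<close>).
\<close>

section \<open>Sets and ordinals of the metatheory\<close>

text \<open>
  The class \<open>zfc_universe\<close> supplies sets \<open>b\<close> with a prescribed \<open>elts b\<close>. Phrased
  for \<open>small\<close> classes, its axioms become closure properties of \<open>small\<close>, and no
  witnesses have to be carried through the constructions below.
\<close>

definition small :: "'v::zfc_universe set \<Rightarrow> bool" where
  "small X \<longleftrightarrow> (\<exists>b. elts b = X)"

lemma elts_vset_small: "small X \<Longrightarrow> elts (vset X) = X"
  by (auto simp: small_def elts_vset)

lemma small_elts [simp]: "small (elts x)"
  by (auto simp: small_def)

lemma small_subset: "small X \<Longrightarrow> Y \<subseteq> X \<Longrightarrow> small Y"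
proof -
  assume "small X" and sub: "Y \<subseteq> X"
  then obtain b where b: "elts b = X" by (auto simp: small_def)
  obtain c where "elts c = {x \<in> elts b. x \<in> Y}" using separation[of b "\<lambda>x. x \<in> Y"] ..
  then have "elts c = Y" using b sub by auto
  then show "small Y" by (auto simp: small_def)
qed

lemma small_image:
  fixes f :: "'v::zfc_universe \<Rightarrow> 'v"
  shows "small X \<Longrightarrow> small (f ` X)"
  using replacement[of f] by (auto simp: small_def)

lemma small_UN:
  fixes F :: "'v::zfc_universe \<Rightarrow> 'v set"
  assumes "small X" and "\<And>x. x \<in> X \<Longrightarrow> small (F x)"
  shows "small (\<Union>x\<in>X. F x)"
proof -
  obtain c where c: "elts c = (\<lambda>x. vset (F x)) ` X"
    using small_image[OF assms(1), of "\<lambda>x. vset (F x)"] by (auto simp: small_def)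
  obtain d where "elts d = (\<Union>y\<in>elts c. elts y)" using union ..
  also have "\<dots> = (\<Union>x\<in>X. F x)" using c assms(2) by (simp add: elts_vset_small)
  finally show ?thesis by (auto simp: small_def)
qed

lemma small_pair: "small {x, y}"
  using pairing by (auto simp: small_def)

lemma small_Un:
  assumes "small A" "small B" shows "small (A \<union> B)"
proof -
  have "small (\<Union>x\<in>{vset A, vset B}. elts x)" by (intro small_UN small_pair) simp
  then show ?thesis using assms by (simp add: elts_vset_small)
qed

lemma small_insert: "small A \<Longrightarrow> small (insert x A)"
  using small_Un[OF small_pair[of x x]] by simp

lemma small_subsets: "small X \<Longrightarrow> small {y. elts y \<subseteq> X}"
  using powerset by (auto simp: small_def)

lemma vset_pair_eq_iff: "vset {x, y} = vset {x', y'} \<longleftrightarrow> {x, y} = {x', y'}"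
  by (metis elts_vset_pair)

lemma vpair_eq_iff: "vpair x y = vpair x' y' \<longleftrightarrow> x = x' \<and> y = y'"
proof -
  have *: "vset {a} = vset {a, a}" for a :: 'a by simp
  show ?thesis
    unfolding vpair_def vset_pair_eq_iff doubleton_eq_iff *[of x] *[of x'] by auto
qed

lemma small_vdom: "small (vdom u)"
proof -
  have "vdom u \<subseteq> (\<lambda>p. SOME x. \<exists>y. p = vpair x y) ` elts u"
  proof
    fix x assume "x \<in> vdom u"
    then obtain y where y: "vpair x y \<in> elts u" by (auto simp: vdom_def)
    have "(SOME x'. \<exists>y'. vpair x y = vpair x' y') = x"
      by (simp add: vpair_eq_iff)
    then show "x \<in> (\<lambda>p. SOME x. \<exists>y. p = vpair x y) ` elts u"
      using y by (intro image_eqI[where x = "vpair x y"]) (simp_all add: vpair_eq_iff)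
  qed
  then show ?thesis by (rule small_subset[OF small_image[OF small_elts]])
qed

lemma vdom_induct:
  assumes "\<And>u. (\<And>x. x \<in> vdom u \<Longrightarrow> P x) \<Longrightarrow> P u"
  shows "P u"
proof (induction u rule: wf_induct_rule[OF wf_trancl[OF foundation]])
  case (1 u)
  show ?case by (rule assms) (rule 1, rule vdom_trancl)
qed

lemma is_ordinal_elem: "is_ordinal \<alpha> \<Longrightarrow> \<xi> \<in> elts \<alpha> \<Longrightarrow> is_ordinal \<xi>"
  unfolding is_ordinal_def by (meson subsetD)

lemma is_ordinal_UN:
  assumes "\<And>x. x \<in> X \<Longrightarrow> is_ordinal (\<alpha> x)" and "elts \<beta> = (\<Union>x\<in>X. elts (\<alpha> x))"
  shows "is_ordinal \<beta>"
  unfolding is_ordinal_def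
proof (intro conjI ballI)
  fix \<xi> assume "\<xi> \<in> elts \<beta>"
  then obtain x where x: "x \<in> X" "\<xi> \<in> elts (\<alpha> x)" using assms(2) by auto
  then show "elts \<xi> \<subseteq> elts \<beta>"
    using assms by (auto simp: is_ordinal_def)
  fix \<eta> assume "\<eta> \<in> elts \<xi>"
  then show "elts \<eta> \<subseteq> elts \<xi>" using x assms(1)[OF x(1)] by (auto simp: is_ordinal_def)
qed

lemma is_ordinal_insert:
  assumes "is_ordinal \<alpha>" and "elts \<beta> = insert \<alpha> (elts \<alpha>)"
  shows "is_ordinal \<beta>"
  using assms by (auto simp: is_ordinal_def)


section \<open>Forcing-style rules for complete Boolean algebras\<close>

text \<open>
  With \<open>p \<le> a\<close> read as ``\<open>p\<close> forces \<open>a\<close>'', this and the next rule are the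
  Kripke clauses for implication and negation; the first is the adjunction between meet and implication.
\<close>

lemma le_imp_iff:
  fixes a b p :: "'a::boolean_algebra"
  shows "p \<le> sup (- a) b \<longleftrightarrow> (\<forall>q\<le>p. q \<le> a \<longrightarrow> q \<le> b)"
  by (metis inf.boundedI inf.cobounded1 inf.cobounded2 order.trans shunt1)

lemma le_uminus_iff:
  fixes a p :: "'a::boolean_algebra"
  shows "p \<le> - a \<longleftrightarrow> (\<forall>q\<le>p. q \<le> a \<longrightarrow> q = bot)"
  using le_imp_iff[of p a bot] by (simp add: bot_unique)

text \<open>
  This is the infinite distributive law \<open>inf p (Sup A) = Sup (inf p ` A)\<close> as an elimination
  rule. It holds in every complete Boolean algebra because \<open>inf p a \<le> c\<close> amounts to
  \<open>a \<le> sup (- p) c\<close>, a bound that passes to suprema.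
\<close>

lemma le_SUP_E:
  fixes p c :: "'a::{complete_lattice, boolean_algebra}"
  assumes "p \<le> (SUP x\<in>A. f x)"
    and "\<And>x q. x \<in> A \<Longrightarrow> q \<le> p \<Longrightarrow> q \<le> f x \<Longrightarrow> q \<le> c"
  shows "p \<le> c"
proof -
  have "f x \<le> sup (- p) c" if "x \<in> A" for x
    unfolding le_imp_iff using assms(2)[OF that] by blast
  then have "(SUP x\<in>A. f x) \<le> sup (- p) c" by (rule SUP_least)
  then have "p \<le> sup (- p) c" using assms(1) by (rule order_trans[rotated])
  then show ?thesis by (simp add: le_imp_iff)
qed

lemma le_SUP_I:
  fixes p :: "'a::complete_lattice"
  shows "x \<in> A \<Longrightarrow> p \<le> f x \<Longrightarrow> p \<le> (SUP x\<in>A. f x)"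
  by (rule SUP_upper2)

lemma le_supE:
  fixes p c :: "'a::boolean_algebra"
  assumes "p \<le> sup a b"
    and "\<And>q. q \<le> p \<Longrightarrow> q \<le> a \<Longrightarrow> q \<le> c" and "\<And>q. q \<le> p \<Longrightarrow> q \<le> b \<Longrightarrow> q \<le> c"
  shows "p \<le> c"
proof -
  have "p = sup (inf p a) (inf p b)"
    using assms(1) by (simp add: inf_absorb1 flip: inf_sup_distrib1)
  moreover have "inf p a \<le> c" "inf p b \<le> c" using assms(2,3) by simp_all
  ultimately show ?thesis by (metis sup.bounded_iff)
qed

lemma le_cases:
  fixes p a c :: "'a::boolean_algebra"
  assumes "\<And>q. q \<le> p \<Longrightarrow> q \<le> a \<Longrightarrow> q \<le> c" and "\<And>q. q \<le> p \<Longrightarrow> q \<le> - a \<Longrightarrow> q \<le> c"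
  shows "p \<le> c"
  by (rule le_supE[of p a "- a"]) (auto intro: assms)


section \<open>Boolean truth values\<close>

lemma fst_twist_and [simp]: "fst (twist_and z w) = inf (fst z) (fst w)"
  by (cases z; cases w) simp

lemma fst_twist_or [simp]: "fst (twist_or z w) = sup (fst z) (fst w)"
  by (cases z; cases w) simp

lemma fst_twist_imp [simp]: "fst (twist_imp z w) = sup (- fst z) (fst w)"
  by (cases z; cases w) simp

lemma fst_twist_snot [simp]: "fst (twist_snot z) = - fst z"
  by (cases z) simp

lemma fst_twist_Inf [simp]: "fst (twist_Inf (f ` A)) = (INF x\<in>A. fst (f x))"
  by (simp add: twist_Inf_def image_image)

lemma fst_twist_Sup [simp]: "fst (twist_Sup (f ` A)) = (SUP x\<in>A. fst (f x))"
  by (simp add: twist_Sup_def image_image)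

lemma designated_iff: "z \<in> designated \<longleftrightarrow> fst z = top"
  by (cases z) (auto simp: designated_def)

text \<open>
  The constants \<open>app\<close>, \<open>mem\<close> and \<open>eqv\<close> below are the first coordinates of the
  weights and of the atomic values; their recursion equations involve first coordinates only.
\<close>

locale twist_model =
  fixes code :: "'a::{complete_lattice, boolean_algebra} \<Rightarrow> 'v::zfc_universe"
  assumes inj_code: "inj code" and small_code: "small (range code)"
begin

abbreviation V :: "'v set" where "V \<equiv> V_twist code"

definition app :: "'v \<Rightarrow> 'v \<Rightarrow> 'a" where "app u x = fst (twist_app code u x)"
definition mem :: "'v \<Rightarrow> 'v \<Rightarrow> 'a" where "mem u v = fst (val_mem code u v)"
definition eqv :: "'v \<Rightarrow> 'v \<Rightarrow> 'a" where "eqv u v = fst (val_eq code u v)"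

lemma mem_eq: "mem u v = (SUP x\<in>vdom v. inf (app v x) (eqv x u))"
  by (simp add: mem_def eqv_def app_def val_mem.simps[of code u v])

lemma eqv_eq:
  "eqv u v = inf (INF x\<in>vdom u. sup (- app u x) (mem x v)) (INF x\<in>vdom v. sup (- app v x) (mem x u))"
  by (simp add: mem_def eqv_def app_def val_eq.simps[of code u v])

lemma memI: "x \<in> vdom v \<Longrightarrow> p \<le> app v x \<Longrightarrow> p \<le> eqv x u \<Longrightarrow> p \<le> mem u v"
  unfolding mem_eq by (rule le_SUP_I) auto

lemma memE_app:
  assumes "p \<le> mem u v"
    and "\<And>x q. x \<in> vdom v \<Longrightarrow> q \<le> p \<Longrightarrow> q \<le> app v x \<Longrightarrow> q \<le> eqv x u \<Longrightarrow> q \<le> c"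
  shows "p \<le> c"
  using assms(1) unfolding mem_eq by (rule le_SUP_E) (use assms(2) in auto)

lemma eqvI:
  assumes "\<And>x q. x \<in> vdom u \<Longrightarrow> q \<le> p \<Longrightarrow> q \<le> app u x \<Longrightarrow> q \<le> mem x v"
    and "\<And>x q. x \<in> vdom v \<Longrightarrow> q \<le> p \<Longrightarrow> q \<le> app v x \<Longrightarrow> q \<le> mem x u"
  shows "p \<le> eqv u v"
  using assms by (simp add: eqv_eq le_INF_iff le_imp_iff)

lemma eqv_sym: "p \<le> eqv u v \<Longrightarrow> p \<le> eqv v u"
  by (simp add: eqv_eq[of u v] eqv_eq[of v u] inf.commute)

lemma eqv_app_mem:
  "p \<le> eqv u v \<Longrightarrow> x \<in> vdom u \<Longrightarrow> p \<le> app u x \<Longrightarrow> p \<le> mem x v"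
  by (auto simp: eqv_eq le_INF_iff le_imp_iff)

lemma eqv_refl [simp]: "p \<le> eqv u u"
proof (induction u arbitrary: p rule: vdom_induct)
  case (1 u)
  show ?case by (rule eqvI) (rule memI, assumption, assumption, rule 1, assumption)+
qed

lemma app_mem: "x \<in> vdom u \<Longrightarrow> p \<le> app u x \<Longrightarrow> p \<le> mem x u"
  by (rule memI) auto

text \<open>
  Transitivity is proved by induction on one of the outer names: a member \<open>x\<close> of \<open>u\<close> is
  matched with some \<open>y\<close> in \<open>v\<close> and this with some \<open>z\<close> in \<open>w\<close>; the
  converse inclusion meets the same triple in reverse order. Since \<open>eqv\<close> is symmetric, both
  times the instance needed is the one that starts at \<open>x \<in> vdom u\<close>.
\<close>

lemma eqv_trans: "p \<le> eqv u v \<Longrightarrow> p \<le> eqv v w \<Longrightarrow> p \<le> eqv u w"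
proof (induction u arbitrary: p v w rule: vdom_induct)
  case (1 u)
  show ?case
  proof (rule eqvI)
    fix x q assume x: "x \<in> vdom u" and q: "q \<le> p" "q \<le> app u x"
    have "q \<le> mem x v" using "1.prems"(1) x q by (meson eqv_app_mem order_trans)
    then show "q \<le> mem x w"
    proof (rule memE_app)
      fix y r assume y: "y \<in> vdom v" and r: "r \<le> q" "r \<le> app v y" "r \<le> eqv y x"
      have "r \<le> mem y w" using "1.prems"(2) y q r by (meson eqv_app_mem order_trans)
      then show "r \<le> mem x w"
      proof (rule memE_app)
        fix z s assume z: "z \<in> vdom w" and s: "s \<le> r" "s \<le> app w z" "s \<le> eqv z y"
        have "s \<le> eqv x z" using "1.IH"[OF x] r s by (meson eqv_sym order_trans)
        then show "s \<le> mem x w" using z s by (meson memI eqv_sym)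
      qed
    qed
  next
    fix z q assume z: "z \<in> vdom w" and q: "q \<le> p" "q \<le> app w z"
    have "q \<le> mem z v" using "1.prems"(2) z q by (meson eqv_app_mem eqv_sym order_trans)
    then show "q \<le> mem z u"
    proof (rule memE_app)
      fix y r assume y: "y \<in> vdom v" and r: "r \<le> q" "r \<le> app v y" "r \<le> eqv y z"
      have "r \<le> mem y u" using "1.prems"(1) y q r by (meson eqv_app_mem eqv_sym order_trans)
      then show "r \<le> mem z u"
      proof (rule memE_app)
        fix x s assume x: "x \<in> vdom u" and s: "s \<le> r" "s \<le> app u x" "s \<le> eqv x y"
        have "s \<le> eqv x z" using "1.IH"[OF x] r s by (meson order_trans)
        then show "s \<le> mem z u" using x s by (meson memI)
      qed
    qed
  qed
qed

lemma mem_eqv_left: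
  assumes "p \<le> eqv u w" "p \<le> mem u v" shows "p \<le> mem w v"
  using assms(2)
proof (rule memE_app)
  fix x q assume x: "x \<in> vdom v" and q: "q \<le> p" "q \<le> app v x" "q \<le> eqv x u"
  have "q \<le> eqv x w" using q assms(1) by (meson eqv_trans order_trans)
  with x q show "q \<le> mem w v" by (meson memI)
qed

lemma mem_eqv_right:
  assumes "p \<le> eqv u v" "p \<le> mem w u" shows "p \<le> mem w v"
  using assms(2)
proof (rule memE_app)
  fix x q assume x: "x \<in> vdom u" and q: "q \<le> p" "q \<le> app u x" "q \<le> eqv x w"
  have "q \<le> mem x v" using x q assms(1) by (meson eqv_app_mem order_trans)
  with q show "q \<le> mem w v" by (meson mem_eqv_left)
qed

lemma memE:
  assumes "p \<le> mem u v"
    and "\<And>x q. x \<in> vdom v \<Longrightarrow> q \<le> p \<Longrightarrow> q \<le> mem x v \<Longrightarrow> q \<le> eqv x u \<Longrightarrow> q \<le> c"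
  shows "p \<le> c"
  using assms(1) by (rule memE_app) (auto intro: app_mem assms(2))


section \<open>Names\<close>

text \<open>
  The name with domain \<open>W\<close> and weights \<open>g\<close>. The complement in the second coordinate
  serves to place the pair in the twist domain.
\<close>

definition name :: "'v set \<Rightarrow> ('v \<Rightarrow> 'a) \<Rightarrow> 'v" where
  "name W g = vset ((\<lambda>x. vpair x (twist_code code (g x, - g x))) ` W)"

lemma elts_name:
  "small W \<Longrightarrow> elts (name W g) = (\<lambda>x. vpair x (twist_code code (g x, - g x))) ` W"
  unfolding name_def by (rule elts_vset_small) (rule small_image)

lemma vdom_name: "small W \<Longrightarrow> vdom (name W g) = W"
  by (auto simp: vdom_def elts_name vpair_eq_iff)

lemma twist_code_eq_iff: "twist_code code z = twist_code code w \<longleftrightarrow> z = w"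
  using inj_code by (cases z; cases w) (auto simp: vpair_eq_iff dest: injD)

lemma app_name:
  assumes "small W" "x \<in> W" shows "app (name W g) x = g x"
proof -
  have "vpair x (twist_code code z) \<in> elts (name W g) \<longleftrightarrow> z = (g x, - g x)" for z
    using assms by (auto simp: elts_name vpair_eq_iff twist_code_eq_iff simp del: twist_code.simps)
  then show ?thesis by (simp add: app_def twist_app_def)
qed

text \<open>
  Levels grow with the ordinal, and the union of a set of ordinals is an ordinal. So a set of names
  lies in a single level, and a name with that domain appears one level higher.
\<close>

lemma V_level_bound:
  assumes "small W" "W \<subseteq> V"
  shows "\<exists>\<beta>. is_ordinal \<beta> \<and> W \<subseteq> V_level code \<beta>"
proof -
  have "\<forall>x\<in>W. \<exists>\<alpha>. is_ordinal \<alpha> \<and> x \<in> V_level code \<alpha>"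
    using assms(2) by (auto simp: V_twist_def)
  then obtain \<alpha> where \<alpha>: "\<And>x. x \<in> W \<Longrightarrow> is_ordinal (\<alpha> x)" "\<And>x. x \<in> W \<Longrightarrow> x \<in> V_level code (\<alpha> x)"
    by metis
  have "small (\<Union>x\<in>W. elts (\<alpha> x))" using assms(1) by (rule small_UN) simp
  then obtain \<beta> where \<beta>: "elts \<beta> = (\<Union>x\<in>W. elts (\<alpha> x))" by (auto simp: small_def)
  have "x \<in> V_level code \<beta>" if "x \<in> W" for x
    using \<alpha>(2)[OF that] that \<beta> unfolding V_level.simps[of code \<beta>] V_level.simps[of code "\<alpha> x"] by blast
  with is_ordinal_UN[OF \<alpha>(1) \<beta>] show ?thesis by auto
qed

lemma name_in_V:
  assumes "small W" "W \<subseteq> V" shows "name W g \<in> V"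
proof -
  obtain \<beta> where \<beta>: "is_ordinal \<beta>" "W \<subseteq> V_level code \<beta>" using V_level_bound[OF assms] by auto
  obtain \<gamma> where \<gamma>: "elts \<gamma> = insert \<beta> (elts \<beta>)"
    using small_insert[OF small_elts, of \<beta> \<beta>] by (auto simp: small_def)
  have "is_function (name W g)"
    using assms(1) by (auto simp: is_function_def elts_name vpair_eq_iff simp del: twist_code.simps)
  moreover have "vran (name W g) \<subseteq> twist_code code ` twist_domain"
    using assms(1)
    by (auto simp: vran_def elts_name vpair_eq_iff twist_domain_def simp del: twist_code.simps)
  ultimately have "name W g \<in> V_level code \<gamma>"
    using \<gamma> \<beta>(2) assms(1) unfolding V_level.simps[of code \<gamma>] by (simp add: vdom_name)
  with is_ordinal_insert[OF \<beta>(1) \<gamma>] show ?thesis by (auto simp: V_twist_def)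
qed

lemma vdom_in_V: "u \<in> V \<Longrightarrow> x \<in> vdom u \<Longrightarrow> x \<in> V"
proof -
  assume "u \<in> V" and x: "x \<in> vdom u"
  then obtain \<alpha> where \<alpha>: "is_ordinal \<alpha>" "u \<in> V_level code \<alpha>" by (auto simp: V_twist_def)
  obtain \<xi> where "\<xi> \<in> elts \<alpha>" "vdom u \<subseteq> V_level code \<xi>"
    using \<alpha>(2) unfolding V_level.simps[of code \<alpha>] by blast
  with x is_ordinal_elem[OF \<alpha>(1)] show "x \<in> V" by (auto simp: V_twist_def)
qed

lemma mem_name: "small W \<Longrightarrow> mem y (name W g) = (SUP x\<in>W. inf (g x) (eqv x y))"
  by (simp add: mem_eq vdom_name app_name)

text \<open>
  A Boolean-valued predicate that respects \<open>eqv\<close>. For these, the name with weights \<open>P\<close>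
  has the expected members (\<open>mem_name_iff\<close>): \<open>y\<close> belongs to it to the extent that
  \<open>P y\<close> holds and \<open>y\<close> is equal to something in the domain.
\<close>

definition extensional :: "('v \<Rightarrow> 'a) \<Rightarrow> bool" where
  "extensional P \<longleftrightarrow> (\<forall>p u v. p \<le> eqv u v \<longrightarrow> p \<le> P u \<longrightarrow> p \<le> P v)"

lemma extensionalD: "extensional P \<Longrightarrow> p \<le> eqv u v \<Longrightarrow> p \<le> P u \<Longrightarrow> p \<le> P v"
  by (auto simp: extensional_def)

lemma mem_name_iff:
  assumes "small W" "extensional P"
  shows "p \<le> mem y (name W P) \<longleftrightarrow> p \<le> P y \<and> p \<le> (SUP u\<in>W. eqv u y)"
proof
  assume "p \<le> mem y (name W P)"
  then have *: "p \<le> (SUP x\<in>W. inf (P x) (eqv x y))" by (simp add: mem_name assms(1))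
  from * have "p \<le> P y" by (rule le_SUP_E) (auto intro: extensionalD[OF assms(2)])
  moreover from * have "p \<le> (SUP u\<in>W. eqv u y)" by (rule le_SUP_E) (auto intro: le_SUP_I)
  ultimately show "p \<le> P y \<and> p \<le> (SUP u\<in>W. eqv u y)" ..
next
  assume *: "p \<le> P y \<and> p \<le> (SUP u\<in>W. eqv u y)"
  then have "p \<le> (SUP u\<in>W. eqv u y)" ..
  then show "p \<le> mem y (name W P)"
    unfolding mem_name[OF assms(1)]
  proof (rule le_SUP_E)
    fix u q assume u: "u \<in> W" "q \<le> p" "q \<le> eqv u y"
    have "q \<le> P u" using u * extensionalD[OF assms(2)] by (meson eqv_sym order_trans)
    then show "q \<le> (SUP x\<in>W. inf (P x) (eqv x y))" using u by (auto intro: le_SUP_I)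
  qed
qed


section \<open>Forcing of formulas\<close>

definition forces :: "'a \<Rightarrow> (nat \<Rightarrow> 'v) \<Rightarrow> 'v form \<Rightarrow> bool" where
  "forces p e \<phi> \<longleftrightarrow> p \<le> fst (val code e \<phi>)"

text \<open>
  Disjunction and existential quantification are absent here: a condition that forces them need not
  decide which case holds. They have introduction and elimination rules instead.
\<close>

lemma forces_simps [simp]:
  "forces p e (s \<^bold>\<in> t) \<longleftrightarrow> p \<le> mem (val_trm e s) (val_trm e t)"
  "forces p e (s \<^bold>\<approx> t) \<longleftrightarrow> p \<le> eqv (val_trm e s) (val_trm e t)"
  "forces p e (\<phi> \<^bold>\<and> \<psi>) \<longleftrightarrow> forces p e \<phi> \<and> forces p e \<psi>"
  "forces p e (\<phi> \<^bold>\<longrightarrow> \<psi>) \<longleftrightarrow> (\<forall>q\<le>p. forces q e \<phi> \<longrightarrow> forces q e \<psi>)"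
  "forces p e (\<^bold>\<sim> \<phi>) \<longleftrightarrow> (\<forall>q\<le>p. forces q e \<phi> \<longrightarrow> q = bot)"
  "forces p e (\<^bold>\<forall>x. \<phi>) \<longleftrightarrow> (\<forall>u\<in>V. forces p (e(x := u)) \<phi>)"
  by (simp_all add: forces_def mem_def eqv_def le_imp_iff le_uminus_iff le_INF_iff)

lemma forces_mono: "forces p e \<phi> \<Longrightarrow> q \<le> p \<Longrightarrow> forces q e \<phi>"
  unfolding forces_def by (rule order_trans)

lemma forces_AllI: "(\<And>u. u \<in> V \<Longrightarrow> forces p (e(x := u)) \<phi>) \<Longrightarrow> forces p e (\<^bold>\<forall>x. \<phi>)"
  by simp

lemma forces_ImpI:
  "(\<And>q. q \<le> p \<Longrightarrow> forces q e \<phi> \<Longrightarrow> forces q e \<psi>) \<Longrightarrow> forces p e (\<phi> \<^bold>\<longrightarrow> \<psi>)"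
  by simp

lemma forces_OrI: "forces p e \<phi> \<or> forces p e \<psi> \<Longrightarrow> forces p e (\<phi> \<^bold>\<or> \<psi>)"
  by (auto simp: forces_def intro: le_supI1 le_supI2)

lemma forces_ExI: "u \<in> V \<Longrightarrow> forces p (e(x := u)) \<phi> \<Longrightarrow> forces p e (\<^bold>\<exists>x. \<phi>)"
  by (auto simp: forces_def intro: le_SUP_I)

lemma forces_OrE:
  assumes "forces p e (\<phi> \<^bold>\<or> \<psi>)"
    and "\<And>q. q \<le> p \<Longrightarrow> forces q e \<phi> \<Longrightarrow> q \<le> c" and "\<And>q. q \<le> p \<Longrightarrow> forces q e \<psi> \<Longrightarrow> q \<le> c"
  shows "p \<le> c"
  using assms by (auto simp: forces_def intro: le_supE)

lemma forces_ExE: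
  assumes "forces p e (\<^bold>\<exists>x. \<phi>)"
    and "\<And>u q. u \<in> V \<Longrightarrow> q \<le> p \<Longrightarrow> forces q (e(x := u)) \<phi> \<Longrightarrow> q \<le> c"
  shows "p \<le> c"
  using assms by (auto simp: forces_def intro: le_SUP_E)

lemma validI:
  assumes "\<And>e. (\<And>x. e x \<in> V) \<Longrightarrow> forces top e \<phi>"
  shows "valid code \<phi>"
  using assms by (auto simp: valid_def designated_iff forces_def top_unique)

lemma valid_forces: "valid code \<phi> \<Longrightarrow> (\<And>x. e x \<in> V) \<Longrightarrow> forces p e \<phi>"
  by (auto simp: valid_def designated_iff forces_def)

text \<open>
  Leibniz's law. It needs a pure formula: the truth of \<open>\<^bold>\<not> \<phi>\<close> is the second
  coordinate of the value of \<open>\<phi>\<close>, which \<open>eqv\<close> does not control.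
\<close>

lemma forces_eqv:
  "pure_lang C \<phi> \<Longrightarrow> (\<And>x. p \<le> eqv (e x) (e' x)) \<Longrightarrow> forces p e \<phi> \<Longrightarrow> forces p e' \<phi>"
proof (induction \<phi> arbitrary: p e e')
  case (Mem s t)
  have "p \<le> eqv (val_trm e r) (val_trm e' r)" for r using Mem(2) by (cases r) auto
  then show ?case using Mem(3) by (auto intro: mem_eqv_left mem_eqv_right)
next
  case (Eq s t)
  have "p \<le> eqv (val_trm e r) (val_trm e' r)" for r using Eq(2) by (cases r) auto
  then show ?case using Eq(3) by (auto intro: eqv_trans eqv_sym)
next
  case (And \<phi> \<psi>)
  then show ?case by (simp; blast)
next
  case (Or \<phi> \<psi>)
  show ?case unfolding forces_def
  proof (rule forces_OrE[OF Or.prems(3)])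
    fix q assume q: "q \<le> p" "forces q e \<phi>"
    have "forces q e' \<phi>" using Or.prems q by (intro Or.IH(1)[OF _ _ q(2)]) (auto intro: order_trans)
    then show "q \<le> fst (val code e' (\<phi> \<^bold>\<or> \<psi>))" using forces_OrI by (auto simp: forces_def)
  next
    fix q assume q: "q \<le> p" "forces q e \<psi>"
    have "forces q e' \<psi>" using Or.prems q by (intro Or.IH(2)[OF _ _ q(2)]) (auto intro: order_trans)
    then show "q \<le> fst (val code e' (\<phi> \<^bold>\<or> \<psi>))" using forces_OrI by (auto simp: forces_def)
  qed
next
  case (Imp \<phi> \<psi>)
  show ?case unfolding forces_simps
  proof (intro allI impI)
    fix q assume q: "q \<le> p" "forces q e' \<phi>"
    have *: "q \<le> eqv (e x) (e' x)" for x using Imp.prems(2) q(1) by (rule order_trans[rotated])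
    have "forces q e \<phi>" using Imp.prems(1) by (intro Imp.IH(1)[OF _ _ q(2)]) (auto intro: eqv_sym *)
    then have "forces q e \<psi>" using Imp.prems(3) q by auto
    show "forces q e' \<psi>" by (rule Imp.IH(2)[OF _ * \<open>forces q e \<psi>\<close>]) (use Imp.prems(1) in auto)
  qed
next
  case (SNot \<phi>)
  show ?case unfolding forces_simps
  proof (intro allI impI)
    fix q assume q: "q \<le> p" "forces q e' \<phi>"
    have *: "q \<le> eqv (e x) (e' x)" for x using SNot.prems(2) q(1) by (rule order_trans[rotated])
    have "forces q e \<phi>" using SNot.prems(1) by (intro SNot.IH(1)[OF _ _ q(2)]) (auto intro: eqv_sym *)
    then show "q = bot" using SNot.prems(3) q by auto
  qed
next
  case (PNot \<phi>)
  then show ?case by simp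
next
  case (All x \<phi>)
  show ?case unfolding forces_simps
  proof
    fix u assume "u \<in> V"
    then have "forces p (e(x := u)) \<phi>" using All.prems(3) by simp
    from All.IH[OF _ _ this] All.prems show "forces p (e'(x := u)) \<phi>" by simp
  qed
next
  case (Ex x \<phi>)
  show ?case unfolding forces_def
  proof (rule forces_ExE[OF Ex.prems(3)])
    fix u q assume q: "u \<in> V" "q \<le> p" "forces q (e(x := u)) \<phi>"
    have "forces q (e'(x := u)) \<phi>"
      using Ex.prems q by (intro Ex.IH[OF _ _ q(3)]) (auto intro: order_trans)
    then show "q \<le> fst (val code e' (\<^bold>\<exists>x. \<phi>))"
      using forces_ExI[OF q(1)] by (auto simp: forces_def)
  qed
qed

lemma val_trm_cong: "(\<And>x. x \<in> fv_trm t \<Longrightarrow> e x = e' x) \<Longrightarrow> val_trm e t = val_trm e' t"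
  by (cases t) auto

lemma val_cong: "(\<And>x. x \<in> fv \<phi> \<Longrightarrow> e x = e' x) \<Longrightarrow> val code e \<phi> = val code e' \<phi>"
proof (induction \<phi> arbitrary: e e')
  case (Mem s t)
  then show ?case using val_trm_cong[of s e e'] val_trm_cong[of t e e'] by simp
next
  case (Eq s t)
  then show ?case using val_trm_cong[of s e e'] val_trm_cong[of t e e'] by simp
next
  case (And \<phi> \<psi>)
  have "val code e \<phi> = val code e' \<phi>" "val code e \<psi> = val code e' \<psi>"
    by (rule And.IH, simp add: And.prems)+
  then show ?case by simp
next
  case (Or \<phi> \<psi>)
  have "val code e \<phi> = val code e' \<phi>" "val code e \<psi> = val code e' \<psi>"
    by (rule Or.IH, simp add: Or.prems)+
  then show ?case by simp
next
  case (Imp \<phi> \<psi>)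
  have "val code e \<phi> = val code e' \<phi>" "val code e \<psi> = val code e' \<psi>"
    by (rule Imp.IH, simp add: Imp.prems)+
  then show ?case by simp
next
  case (SNot \<phi>)
  have "val code e \<phi> = val code e' \<phi>" by (rule SNot.IH) (simp add: SNot.prems)
  then show ?case by simp
next
  case (PNot \<phi>)
  have "val code e \<phi> = val code e' \<phi>" by (rule PNot.IH) (simp add: PNot.prems)
  then show ?case by simp
next
  case (All x \<phi>)
  have "val code (e(x := u)) \<phi> = val code (e'(x := u)) \<phi>" for u
    by (rule All.IH) (simp add: All.prems)
  then show ?case by simp
next
  case (Ex x \<phi>)
  have "val code (e(x := u)) \<phi> = val code (e'(x := u)) \<phi>" for u
    by (rule Ex.IH) (simp add: Ex.prems)
  then show ?case by simp
qed

lemma forces_cong: "(\<And>x. x \<in> fv \<phi> \<Longrightarrow> e x = e' x) \<Longrightarrow> forces p e \<phi> \<longleftrightarrow> forces p e' \<phi>"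
  using val_cong unfolding forces_def by metis

lemma val_subst_trm: "val_trm e (subst_trm x t s) = val_trm (e(x := val_trm e t)) s"
  by (cases s) auto

lemma subst_trm_fresh: "x \<notin> fv_trm s \<Longrightarrow> subst_trm x t s = s"
  by (cases s) auto

lemma subst_fresh: "x \<notin> fv \<phi> \<Longrightarrow> subst x t \<phi> = \<phi>"
  by (induction \<phi>) (auto simp: subst_trm_fresh)

lemma val_subst:
  "free_for x t \<phi> \<Longrightarrow> val code e (subst x t \<phi>) = val code (e(x := val_trm e t)) \<phi>"
proof (induction \<phi> arbitrary: e)
  case (All y \<phi>)
  show ?case
  proof (cases "x \<in> fv (\<^bold>\<forall>y. \<phi>)")
    case False
    then show ?thesis by (subst subst_fresh) (auto intro!: val_cong simp del: val.simps)
  next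
    case True
    then have "x \<noteq> y" "y \<notin> fv_trm t" "free_for x t \<phi>" using All.prems by auto
    then have t: "val_trm (e(y := u)) t = val_trm e t" for u
      by (intro val_trm_cong) auto
    have "val code (e(y := u)) (subst x t \<phi>) = val code (e(x := val_trm e t, y := u)) \<phi>" for u
      unfolding All.IH[OF \<open>free_for x t \<phi>\<close>] t fun_upd_twist[OF \<open>x \<noteq> y\<close>] ..
    then show ?thesis using \<open>x \<noteq> y\<close> by (simp del: fun_upd_apply)
  qed
next
  case (Ex y \<phi>)
  show ?case
  proof (cases "x \<in> fv (\<^bold>\<exists>y. \<phi>)")
    case False
    then show ?thesis by (subst subst_fresh) (auto intro!: val_cong simp del: val.simps)
  next
    case True
    then have "x \<noteq> y" "y \<notin> fv_trm t" "free_for x t \<phi>" using Ex.prems by auto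
    then have t: "val_trm (e(y := u)) t = val_trm e t" for u
      by (intro val_trm_cong) auto
    have "val code (e(y := u)) (subst x t \<phi>) = val code (e(x := val_trm e t, y := u)) \<phi>" for u
      unfolding Ex.IH[OF \<open>free_for x t \<phi>\<close>] t fun_upd_twist[OF \<open>x \<noteq> y\<close>] ..
    then show ?thesis using \<open>x \<noteq> y\<close> by (simp del: fun_upd_apply)
  qed
qed (simp_all add: val_subst_trm)

lemma forces_subst:
  "free_for x t \<phi> \<Longrightarrow> forces p e (subst x t \<phi>) \<longleftrightarrow> forces p (e(x := val_trm e t)) \<phi>"
  by (simp add: forces_def val_subst)


section \<open>The axioms\<close>

text \<open>
  The elimination rules conclude that \<open>p\<close> lies below an arbitrary \<open>c\<close>. The case where
  \<open>c\<close> is a truth value is the one used to prove that \<open>p\<close> forces a formula.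
\<close>

lemmas forces_by_cases = le_cases[where c = "fst (val code e \<psi>)" for e \<psi>, folded forces_def]
lemmas forces_by_SUP = le_SUP_E[where c = "fst (val code e \<psi>)" for e \<psi>, folded forces_def]
lemmas forces_by_mem = memE[where c = "fst (val code e \<psi>)" for e \<psi>, folded forces_def]
lemmas forces_by_Ex = forces_ExE[where c = "fst (val code e \<psi>)" for e \<psi>, folded forces_def]
lemmas forces_by_Or = forces_OrE[where c = "fst (val code e \<psi>)" for e \<psi>, folded forces_def]

lemma mem_bound: "p \<le> mem y u \<Longrightarrow> p \<le> (SUP x\<in>vdom u. eqv x y)"
  by (erule memE) (rule le_SUP_I)

lemma vdom_subset_V: "u \<in> V \<Longrightarrow> vdom u \<subseteq> V"
  by (auto intro: vdom_in_V)

text \<open>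
  The value of \<open>u \<approx> v\<close> tests only elements of the two domains, and these are among the
  names over which the quantifier of the axiom ranges.
\<close>

lemma valid_extensionality:
  assumes "distinct [x, y, z]"
  shows "valid code (\<^bold>\<forall>x. \<^bold>\<forall>y. ((\<^bold>\<forall>z. (Var z \<^bold>\<in> Var x \<^bold>\<longleftrightarrow> Var z \<^bold>\<in> Var y)) \<^bold>\<longrightarrow> Var x \<^bold>\<approx> Var y))"
proof (rule validI)
  fix e
  show "forces top e (\<^bold>\<forall>x. \<^bold>\<forall>y. ((\<^bold>\<forall>z. (Var z \<^bold>\<in> Var x \<^bold>\<longleftrightarrow> Var z \<^bold>\<in> Var y)) \<^bold>\<longrightarrow> Var x \<^bold>\<approx> Var y))"
  proof (intro forces_AllI forces_ImpI)
    fix u v q assume V: "u \<in> V" "v \<in> V"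
      and "forces q (e(x := u, y := v)) (\<^bold>\<forall>z. (Var z \<^bold>\<in> Var x \<^bold>\<longleftrightarrow> Var z \<^bold>\<in> Var y))"
    then have same: "r \<le> mem w u \<longleftrightarrow> r \<le> mem w v" if "w \<in> V" "r \<le> q" for w r
      using assms that by auto
    have "q \<le> eqv u v"
    proof (rule eqvI)
      fix w r assume "w \<in> vdom u" "r \<le> q" "r \<le> app u w"
      then show "r \<le> mem w v" using same[of w r] vdom_in_V[OF V(1)] app_mem by blast
    next
      fix w r assume "w \<in> vdom v" "r \<le> q" "r \<le> app v w"
      then show "r \<le> mem w u" using same[of w r] vdom_in_V[OF V(2)] app_mem by blast
    qed
    then show "forces q (e(x := u, y := v)) (Var x \<^bold>\<approx> Var y)" using assms by simp
  qed
qed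

text \<open>
  By induction on the name \<open>v\<close>: a condition that puts \<open>v\<close> into \<open>u\<close> forces
  \<open>u\<close> to have a minimal element. Below it, either \<open>v\<close> is disjoint from \<open>u\<close> and
  hence minimal, or they share a member, which is equal to an element of \<open>vdom v\<close>, and the
  induction hypothesis applies to that element.
\<close>

lemma valid_foundation:
  assumes "distinct [x, y, z]"
  shows "valid code (\<^bold>\<forall>x. ((\<^bold>\<exists>y. Var y \<^bold>\<in> Var x) \<^bold>\<longrightarrow>
      (\<^bold>\<exists>y. (Var y \<^bold>\<in> Var x \<^bold>\<and> \<^bold>\<sim> (\<^bold>\<exists>z. (Var z \<^bold>\<in> Var x \<^bold>\<and> Var z \<^bold>\<in> Var y))))))"
    (is "valid code (\<^bold>\<forall>x. (?nonempty \<^bold>\<longrightarrow> ?minimal))")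
proof (rule validI)
  fix e
  let ?meets = "\<^bold>\<exists>z. (Var z \<^bold>\<in> Var x \<^bold>\<and> Var z \<^bold>\<in> Var y)"
  have minimal: "forces q (e(x := u)) ?minimal" if "v \<in> V" "q \<le> mem v u" for q u v
    using that
  proof (induction v arbitrary: q rule: vdom_induct)
    case (1 v)
    show ?case
    proof (rule forces_by_cases[where a = "fst (val code (e(x := u, y := v)) ?meets)"])
      fix r assume r: "r \<le> q" "r \<le> fst (val code (e(x := u, y := v)) ?meets)"
      from r(2)[folded forces_def] show "forces r (e(x := u)) ?minimal"
      proof (rule forces_by_Ex)
        fix w s assume "w \<in> V" "s \<le> r"
          "forces s (e(x := u, y := v, z := w)) (Var z \<^bold>\<in> Var x \<^bold>\<and> Var z \<^bold>\<in> Var y)"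
        then have w: "s \<le> mem w u" "s \<le> mem w v" using assms by auto
        from w(2) show "forces s (e(x := u)) ?minimal"
        proof (rule forces_by_mem)
          fix d t assume d: "d \<in> vdom v" "t \<le> s" "t \<le> eqv d w"
          have "t \<le> mem d u" using w(1) d by (meson mem_eqv_left eqv_sym order_trans)
          then show "forces t (e(x := u)) ?minimal"
            using 1(1)[OF d(1)] vdom_in_V[OF 1(2) d(1)] by blast
        qed
      qed
    next
      fix r assume r: "r \<le> q" "r \<le> - fst (val code (e(x := u, y := v)) ?meets)"
      have "forces r (e(x := u, y := v)) (\<^bold>\<sim> ?meets)"
        using r(2) by (simp add: forces_def)
      moreover have "r \<le> mem v u" using r(1) 1(3) by (rule order_trans)
      ultimately have "forces r (e(x := u, y := v)) (Var y \<^bold>\<in> Var x \<^bold>\<and> \<^bold>\<sim> ?meets)"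
        using assms by simp
      with 1(2) show "forces r (e(x := u)) ?minimal" by (rule forces_ExI)
    qed
  qed
  have "forces q (e(x := u)) ?minimal" if "forces q (e(x := u)) ?nonempty" for q u
    using that by (rule forces_by_Ex) (rule minimal, use assms in auto)
  then show "forces top e (\<^bold>\<forall>x. (?nonempty \<^bold>\<longrightarrow> ?minimal))" by (intro forces_AllI forces_ImpI)
qed

text \<open>
  The witness is the name with domain \<open>W\<close> that gives to each \<open>u\<close> the truth value of
  \<open>\<phi>(u)\<close> as weight. Extensionality of this weight is Leibniz's law; the bound says that
  \<open>W\<close> is large enough.
\<close>

lemma forces_comprehension:
  assumes \<phi>: "pure_lang C \<phi>" "b \<notin> fv \<phi>" and "b \<noteq> x" and W: "small W" "W \<subseteq> V"
    and bound: "\<And>q u. u \<in> V \<Longrightarrow> q \<le> p \<Longrightarrow> forces q (e(x := u)) \<phi> \<Longrightarrow> q \<le> (SUP w\<in>W. eqv w u)"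
  shows "forces p e (\<^bold>\<exists>b. \<^bold>\<forall>x. (Var x \<^bold>\<in> Var b \<^bold>\<longleftrightarrow> \<phi>))"
proof (rule forces_ExI)
  define P where "P u = fst (val code (e(x := u)) \<phi>)" for u
  have P: "q \<le> P u \<longleftrightarrow> forces q (e(x := u)) \<phi>" for q u by (simp add: P_def forces_def)
  have "extensional P"
    unfolding extensional_def P
  proof (intro allI impI)
    fix q u v assume "q \<le> eqv u v" "forces q (e(x := u)) \<phi>"
    then show "forces q (e(x := v)) \<phi>" using forces_eqv[OF \<phi>(1), of q "e(x := u)" "e(x := v)"] by auto
  qed
  note mem_iff = mem_name_iff[OF W(1) this]
  show "name W P \<in> V" using W by (rule name_in_V)
  have \<phi>_iff: "forces q (e(b := name W P, x := u)) \<phi> \<longleftrightarrow> q \<le> P u" for q u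
    unfolding P using \<phi>(2) by (intro forces_cong) auto
  show "forces p (e(b := name W P)) (\<^bold>\<forall>x. (Var x \<^bold>\<in> Var b \<^bold>\<longleftrightarrow> \<phi>))"
    using \<open>b \<noteq> x\<close> bound by (simp add: \<phi>_iff mem_iff) (simp add: P)
qed

lemma valid_separation:
  assumes "pure_lang C \<phi>" "distinct [a, b, x]" "b \<notin> fv \<phi>"
  shows "valid code (\<^bold>\<forall>a. \<^bold>\<exists>b. \<^bold>\<forall>x. (Var x \<^bold>\<in> Var b \<^bold>\<longleftrightarrow> Var x \<^bold>\<in> Var a \<^bold>\<and> \<phi>))"
proof (rule validI)
  fix e
  have "forces top (e(a := A)) (\<^bold>\<exists>b. \<^bold>\<forall>x. (Var x \<^bold>\<in> Var b \<^bold>\<longleftrightarrow> Var x \<^bold>\<in> Var a \<^bold>\<and> \<phi>))"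
    if "A \<in> V" for A
    by (rule forces_comprehension[where C = C and W = "vdom A"])
       (use assms that in \<open>auto simp: small_vdom vdom_subset_V intro: mem_bound\<close>)
  then show "forces top e (\<^bold>\<forall>a. \<^bold>\<exists>b. \<^bold>\<forall>x. (Var x \<^bold>\<in> Var b \<^bold>\<longleftrightarrow> Var x \<^bold>\<in> Var a \<^bold>\<and> \<phi>))"
    by (intro forces_AllI)
qed

lemma valid_pairing:
  assumes "distinct [x, y, z, w]"
  shows "valid code (\<^bold>\<forall>x. \<^bold>\<forall>y. \<^bold>\<exists>z. \<^bold>\<forall>w. (Var w \<^bold>\<in> Var z \<^bold>\<longleftrightarrow> Var w \<^bold>\<approx> Var x \<^bold>\<or> Var w \<^bold>\<approx> Var y))"
proof (rule validI)
  fix e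
  have "forces top (e(x := u, y := v)) (\<^bold>\<exists>z. \<^bold>\<forall>w. (Var w \<^bold>\<in> Var z \<^bold>\<longleftrightarrow> Var w \<^bold>\<approx> Var x \<^bold>\<or> Var w \<^bold>\<approx> Var y))"
    if "u \<in> V" "v \<in> V" for u v
  proof (rule forces_comprehension[where C = UNIV and W = "{u, v}"])
    fix q t assume "forces q (e(x := u, y := v, w := t)) (Var w \<^bold>\<approx> Var x \<^bold>\<or> Var w \<^bold>\<approx> Var y)"
    then show "q \<le> (SUP w\<in>{u, v}. eqv w t)"
      by (rule forces_OrE)
         (use assms in \<open>auto intro: le_supI1 le_supI2 eqv_sym\<close>)
  qed (use assms that in \<open>auto simp: small_pair\<close>)
  then show "forces top e (\<^bold>\<forall>x. \<^bold>\<forall>y. \<^bold>\<exists>z. \<^bold>\<forall>w. (Var w \<^bold>\<in> Var z \<^bold>\<longleftrightarrow> Var w \<^bold>\<approx> Var x \<^bold>\<or> Var w \<^bold>\<approx> Var y))"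
    by (intro forces_AllI)
qed

lemma valid_union:
  assumes "distinct [a, b, x, y]"
  shows "valid code (\<^bold>\<forall>a. \<^bold>\<exists>b. \<^bold>\<forall>x. (Var x \<^bold>\<in> Var b \<^bold>\<longleftrightarrow> (\<^bold>\<exists>y. (Var y \<^bold>\<in> Var a \<^bold>\<and> Var x \<^bold>\<in> Var y))))"
proof (rule validI)
  fix e
  have "forces top (e(a := A)) (\<^bold>\<exists>b. \<^bold>\<forall>x. (Var x \<^bold>\<in> Var b \<^bold>\<longleftrightarrow> (\<^bold>\<exists>y. (Var y \<^bold>\<in> Var a \<^bold>\<and> Var x \<^bold>\<in> Var y))))"
    if A: "A \<in> V" for A
  proof (rule forces_comprehension[where C = UNIV and W = "\<Union>u\<in>vdom A. vdom u"])
    fix q t assume "forces q (e(a := A, x := t)) (\<^bold>\<exists>y. (Var y \<^bold>\<in> Var a \<^bold>\<and> Var x \<^bold>\<in> Var y))"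
    then show "q \<le> (SUP w\<in>(\<Union>u\<in>vdom A. vdom u). eqv w t)"
    proof (rule forces_ExE)
      fix v r assume "forces r (e(a := A, x := t, y := v)) (Var y \<^bold>\<in> Var a \<^bold>\<and> Var x \<^bold>\<in> Var y)"
      then have v: "r \<le> mem v A" "r \<le> mem t v" using assms by auto
      from v(1) show "r \<le> (SUP w\<in>(\<Union>u\<in>vdom A. vdom u). eqv w t)"
      proof (rule memE)
        fix u s assume u: "u \<in> vdom A" "s \<le> r" "s \<le> eqv u v"
        have "s \<le> mem t u" using u v(2) by (meson eqv_sym mem_eqv_right order_trans)
        then show "s \<le> (SUP w\<in>(\<Union>u\<in>vdom A. vdom u). eqv w t)"
          by (rule memE) (use u(1) in \<open>auto intro: le_SUP_I\<close>)
      qed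
    qed
  next
    show "small (\<Union>u\<in>vdom A. vdom u)" by (intro small_UN small_vdom)
    show "(\<Union>u\<in>vdom A. vdom u) \<subseteq> V" using A by (auto intro: vdom_in_V)
  qed (use assms in auto)
  then show "forces top e (\<^bold>\<forall>a. \<^bold>\<exists>b. \<^bold>\<forall>x. (Var x \<^bold>\<in> Var b \<^bold>\<longleftrightarrow> (\<^bold>\<exists>y. (Var y \<^bold>\<in> Var a \<^bold>\<and> Var x \<^bold>\<in> Var y))))"
    by (intro forces_AllI)
qed

text \<open>
  A name with domain \<open>W\<close> is a subset of the product of \<open>W\<close> with the set of codes of
  twist values.
\<close>

lemma small_names: "small W \<Longrightarrow> small (range (name W))"
proof -
  assume W: "small W"
  define T where "T = (\<Union>c\<in>range code. vpair c ` range code)"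
  define X where "X = (\<Union>x\<in>W. vpair x ` T)"
  have "small X"
    unfolding X_def T_def by (intro small_UN small_image W small_code)
  moreover have "range (name W) \<subseteq> {y. elts y \<subseteq> X}"
  proof (clarsimp simp: elts_name[OF W] simp del: twist_code.simps)
    fix g x assume "x \<in> W"
    moreover have "twist_code code (g x, - g x) \<in> T" by (auto simp: T_def)
    ultimately show "vpair x (twist_code code (g x, - g x)) \<in> X" by (auto simp: X_def simp del: twist_code.simps)
  qed
  ultimately show ?thesis by (blast intro: small_subset small_subsets)
qed

text \<open>
  A subset \<open>t\<close> of \<open>A\<close> need not have its domain inside that of \<open>A\<close>, but it is equal to the
  name on \<open>vdom A\<close> with weights \<open>mem d t\<close>. Hence the names with domain \<open>vdom A\<close>, of
  which there is only a set, bound the power set.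
\<close>

lemma valid_powerset:
  assumes "distinct [a, b, x, y]"
  shows "valid code (\<^bold>\<forall>a. \<^bold>\<exists>b. \<^bold>\<forall>x.
      (Var x \<^bold>\<in> Var b \<^bold>\<longleftrightarrow> (\<^bold>\<forall>y. (Var y \<^bold>\<in> Var x \<^bold>\<longrightarrow> Var y \<^bold>\<in> Var a))))"
proof (rule validI)
  fix e
  have "forces top (e(a := A)) (\<^bold>\<exists>b. \<^bold>\<forall>x.
      (Var x \<^bold>\<in> Var b \<^bold>\<longleftrightarrow> (\<^bold>\<forall>y. (Var y \<^bold>\<in> Var x \<^bold>\<longrightarrow> Var y \<^bold>\<in> Var a))))"
    if A: "A \<in> V" for A
  proof (rule forces_comprehension[where C = UNIV and W = "range (name (vdom A))"])
    fix q t assume t: "t \<in> V"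
      and "forces q (e(a := A, x := t)) (\<^bold>\<forall>y. (Var y \<^bold>\<in> Var x \<^bold>\<longrightarrow> Var y \<^bold>\<in> Var a))"
    then have sub: "r \<le> mem u A" if "u \<in> V" "r \<le> q" "r \<le> mem u t" for u r
      using assms that by auto
    let ?t = "name (vdom A) (\<lambda>d. mem d t)"
    have "q \<le> eqv ?t t"
    proof (rule eqvI)
      fix d r assume "d \<in> vdom ?t" "r \<le> app ?t d"
      then show "r \<le> mem d t" by (simp add: vdom_name small_vdom app_name)
    next
      fix d r assume d: "d \<in> vdom t" "r \<le> q" "r \<le> app t d"
      then have "r \<le> mem d A" using sub t by (meson app_mem vdom_in_V)
      then show "r \<le> mem d ?t"
      proof (rule memE)
        fix d' s assume d': "d' \<in> vdom A" "s \<le> r" "s \<le> eqv d' d"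
        have "s \<le> mem d t" using d d' by (meson app_mem order_trans)
        then have "s \<le> mem d' t" using d' by (meson eqv_sym mem_eqv_left)
        with d' show "s \<le> mem d ?t" by (intro memI[of d']) (simp_all add: vdom_name small_vdom app_name)
      qed
    qed
    then show "q \<le> (SUP w\<in>range (name (vdom A)). eqv w t)" by (intro le_SUP_I[of ?t]) auto
  next
    show "range (name (vdom A)) \<subseteq> V" using A by (auto intro!: name_in_V small_vdom vdom_subset_V)
  qed (use assms in \<open>auto simp: small_names small_vdom\<close>)
  then show "forces top e (\<^bold>\<forall>a. \<^bold>\<exists>b. \<^bold>\<forall>x.
      (Var x \<^bold>\<in> Var b \<^bold>\<longleftrightarrow> (\<^bold>\<forall>y. (Var y \<^bold>\<in> Var x \<^bold>\<longrightarrow> Var y \<^bold>\<in> Var a))))"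
    by (intro forces_AllI)
qed

text \<open>
  The names \<open>u\<close> form a proper class, but for each \<open>x\<close> the values \<open>F x u\<close> lie in
  the algebra, which is a set. Picking one name for every \<open>x\<close> and every value attained gives
  \<open>W\<close>.
\<close>

lemma collection:
  fixes F :: "'v \<Rightarrow> 'v \<Rightarrow> 'a"
  assumes "small X"
  shows "\<exists>W. small W \<and> W \<subseteq> V \<and> (\<forall>x\<in>X. \<forall>u\<in>V. \<exists>w\<in>W. F x w = F x u)"
proof -
  define pick where "pick x c = (SOME u. u \<in> V \<and> code (F x u) = c)" for x c
  define W where "W = (\<Union>x\<in>X. pick x ` (\<lambda>u. code (F x u)) ` V)"
  have pick: "pick x (code (F x u)) \<in> V \<and> code (F x (pick x (code (F x u)))) = code (F x u)"
    if "u \<in> V" for x u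
    unfolding pick_def by (rule someI[where x = u]) (simp add: that)
  have "small W" unfolding W_def
    by (intro small_UN small_image assms small_subset[OF small_code]) auto
  moreover have "W \<subseteq> V" using pick by (auto simp: W_def)
  moreover have "\<exists>w\<in>W. F x w = F x u" if "x \<in> X" "u \<in> V" for x u
  proof
    show "pick x (code (F x u)) \<in> W" using that by (auto simp: W_def)
    show "F x (pick x (code (F x u))) = F x u" using pick[OF that(2)] inj_code by (auto dest: injD)
  qed
  ultimately show ?thesis by blast
qed

text \<open>
  The bound is the set \<open>W\<close> of \<open>collection\<close> for the truth value of \<open>\<phi>\<close>. If a
  condition forces \<open>\<phi>(u', t)\<close>, then some \<open>v'\<close> in \<open>W\<close> gives \<open>\<phi>(u', v')\<close>
  the same truth value as \<open>\<phi>(u', t)\<close>, and functionality of \<open>\<phi>\<close> makes \<open>t\<close> and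
  \<open>v'\<close> equal.
\<close>

lemma valid_replacement:
  assumes \<phi>: "pure_lang C \<phi>" and dist: "distinct [a, b, x, y, w]" and fresh: "b \<notin> fv \<phi>" "w \<notin> fv \<phi>"
  shows "valid code (\<^bold>\<forall>a. ((\<^bold>\<forall>x. (Var x \<^bold>\<in> Var a \<^bold>\<longrightarrow> Ex1 w y \<phi>)) \<^bold>\<longrightarrow>
      (\<^bold>\<exists>b. \<^bold>\<forall>y. (Var y \<^bold>\<in> Var b \<^bold>\<longleftrightarrow> (\<^bold>\<exists>x. (Var x \<^bold>\<in> Var a \<^bold>\<and> \<phi>))))))"
proof (rule validI)
  fix e
  have "forces p (e(a := A)) (\<^bold>\<exists>b. \<^bold>\<forall>y. (Var y \<^bold>\<in> Var b \<^bold>\<longleftrightarrow> (\<^bold>\<exists>x. (Var x \<^bold>\<in> Var a \<^bold>\<and> \<phi>))))"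
    if A: "A \<in> V" and functional: "forces p (e(a := A)) (\<^bold>\<forall>x. (Var x \<^bold>\<in> Var a \<^bold>\<longrightarrow> Ex1 w y \<phi>))"
    for A p
  proof -
    define F where "F u v = fst (val code (e(a := A, x := u, y := v)) \<phi>)" for u v
    have F: "q \<le> F u v \<longleftrightarrow> forces q (e(a := A, x := u, y := v)) \<phi>" for q u v
      by (simp add: F_def forces_def)
    have xy: "x \<noteq> y" using dist by simp
    obtain W where W: "small W" "W \<subseteq> V" "\<And>u v. u \<in> vdom A \<Longrightarrow> v \<in> V \<Longrightarrow> \<exists>w\<in>W. F u w = F u v"
      using collection[OF small_vdom, of A F] by blast
    show ?thesis
    proof (rule forces_comprehension[where C = C and W = W])
      fix q t assume t: "t \<in> V" "q \<le> p"
        and "forces q (e(a := A, y := t)) (\<^bold>\<exists>x. (Var x \<^bold>\<in> Var a \<^bold>\<and> \<phi>))"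
      from this(3) show "q \<le> (SUP v\<in>W. eqv v t)"
      proof (rule forces_ExE)
        fix u r assume r: "r \<le> q" "forces r (e(a := A, y := t, x := u)) (Var x \<^bold>\<in> Var a \<^bold>\<and> \<phi>)"
        then have u: "r \<le> mem u A" "r \<le> F u t"
          using dist unfolding F fun_upd_twist[OF xy, of "e(a := A)"] by simp_all
        from u(1) show "r \<le> (SUP v\<in>W. eqv v t)"
        proof (rule memE)
          fix u' s assume u': "u' \<in> vdom A" "s \<le> r" "s \<le> mem u' A" "s \<le> eqv u' u"
          have "forces s (e(a := A, x := u, y := t)) \<phi>"
            using u(2) u'(2) by (auto simp: F intro: forces_mono)
          then have "s \<le> F u' t"
            unfolding F by (rule forces_eqv[OF \<phi>, rotated]) (use u'(4) in \<open>auto intro: eqv_sym\<close>)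
          have "u' \<in> V" using A u'(1) by (rule vdom_in_V)
          moreover have "s \<le> p" using u'(2) r(1) t(2) by (meson order_trans)
          ultimately have "forces s (e(a := A, x := u')) (Ex1 w y \<phi>)"
            using functional u'(3) dist by simp
          then show "s \<le> (SUP v\<in>W. eqv v t)"
          proof (rule forces_ExE)
            fix v s' assume s': "s' \<le> s"
              "forces s' (e(a := A, x := u', w := v)) (\<^bold>\<forall>y. (\<phi> \<^bold>\<longleftrightarrow> Var y \<^bold>\<approx> Var w))"
            have \<phi>_iff: "forces s'' (e(a := A, x := u', w := v, y := v')) \<phi> \<longleftrightarrow> s'' \<le> F u' v'" for s'' v'
              unfolding F using fresh dist by (intro forces_cong) auto
            have unique: "s' \<le> eqv v' v" if "v' \<in> V" "s' \<le> F u' v'" for v'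
              using s'(2) that dist by (auto simp: \<phi>_iff)
            obtain v' where v': "v' \<in> W" "F u' v' = F u' t" using W(3)[OF u'(1) t(1)] by blast
            have "s' \<le> F u' t" using s'(1) \<open>s \<le> F u' t\<close> by (rule order_trans)
            then have "s' \<le> eqv v' v" "s' \<le> eqv t v" using unique v' W(2) t(1) by auto
            then have "s' \<le> eqv v' t" by (meson eqv_sym eqv_trans)
            with v'(1) show "s' \<le> (SUP v\<in>W. eqv v t)" by (rule le_SUP_I)
          qed
        qed
      qed
    qed (use \<phi> dist fresh W in auto)
  qed
  then show "forces top e (\<^bold>\<forall>a. ((\<^bold>\<forall>x. (Var x \<^bold>\<in> Var a \<^bold>\<longrightarrow> Ex1 w y \<phi>)) \<^bold>\<longrightarrow>
      (\<^bold>\<exists>b. \<^bold>\<forall>y. (Var y \<^bold>\<in> Var b \<^bold>\<longleftrightarrow> (\<^bold>\<exists>x. (Var x \<^bold>\<in> Var a \<^bold>\<and> \<phi>))))))"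
    by (intro forces_AllI forces_ImpI)
qed

text \<open>
  The canonical name of a set of the metatheory, all of whose members have full weight.
\<close>

function check :: "'v \<Rightarrow> 'v" where
  "check x = name (check ` elts x) (\<lambda>_. top)"
  by auto
termination
  by (relation "{(x, y). x \<in> elts y}") (auto simp: foundation)

declare check.simps [simp del]

lemma check_in_V: "check x \<in> V"
proof (induction x rule: check.induct)
  case (1 x)
  then show ?case
    unfolding check.simps[of x] by (intro name_in_V small_image small_elts) auto
qed

lemma mem_check: "mem u (check x) = (SUP y\<in>elts x. eqv (check y) u)"
  unfolding check.simps[of x] by (simp add: mem_name small_image image_image)

text \<open>
  The witness is \<open>check I\<close>, where \<open>I\<close> is a set of the metatheory that contains the empty
  set and is closed under successor. The members of \<open>check I\<close> are, up to \<open>eqv\<close>, the names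
  \<open>check t\<close> with \<open>t\<close> in \<open>I\<close>, and \<open>check\<close> carries successors to successors.
\<close>

lemma valid_infinity:
  assumes "distinct [a, x, y, z]"
  shows "valid code (\<^bold>\<exists>a. ((\<^bold>\<exists>x. (Var x \<^bold>\<in> Var a \<^bold>\<and> (\<^bold>\<forall>z. \<^bold>\<sim> (Var z \<^bold>\<in> Var x)))) \<^bold>\<and>
      (\<^bold>\<forall>x. (Var x \<^bold>\<in> Var a \<^bold>\<longrightarrow>
        (\<^bold>\<exists>y. (Var y \<^bold>\<in> Var a \<^bold>\<and> (\<^bold>\<forall>z. (Var z \<^bold>\<in> Var y \<^bold>\<longleftrightarrow> Var z \<^bold>\<in> Var x \<^bold>\<or> Var z \<^bold>\<approx> Var x))))))))"
    (is "valid code (\<^bold>\<exists>a. (?zero \<^bold>\<and> (\<^bold>\<forall>x. (_ \<^bold>\<longrightarrow> ?successor))))")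
proof (rule validI)
  fix e
  obtain I :: 'v where infinite: "(\<exists>z\<in>elts I. elts z = {}) \<and>
      (\<forall>t\<in>elts I. \<exists>t'\<in>elts I. elts t' = insert t (elts t))"
    using infinity ..
  then obtain o' where I: "o' \<in> elts I" "elts o' = {}" by auto
  have succ: "\<exists>t'\<in>elts I. elts t' = insert t (elts t)" if "t \<in> elts I" for t
    using infinite that by simp
  let ?e = "e(a := check I)"
  have mem_I: "p \<le> mem (check t) (check I)" if "t \<in> elts I" for p t
    unfolding mem_check by (rule le_SUP_I[OF that]) simp
  have "forces top (?e(x := check o')) (Var x \<^bold>\<in> Var a \<^bold>\<and> (\<^bold>\<forall>z. \<^bold>\<sim> (Var z \<^bold>\<in> Var x)))"
    using assms mem_I[OF I(1)] by (simp add: mem_check[of _ o'] I(2) bot_unique)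
  then have zero: "forces top ?e ?zero" by (rule forces_ExI[OF check_in_V])
  have "forces q (?e(x := u)) ?successor" if "q \<le> mem u (check I)" for q u
    using that unfolding mem_check
  proof (rule forces_by_SUP)
    fix t r assume "t \<in> elts I" and r: "r \<le> eqv (check t) u"
    then obtain t' where t': "t' \<in> elts I" "elts t' = insert t (elts t)" using succ[of t] by auto
    let ?e' = "?e(x := u, y := check t')"
    have mem_t': "mem v (check t') = sup (eqv (check t) v) (mem v (check t))" for v
      by (simp add: mem_check t'(2))
    have "forces r ?e' (\<^bold>\<forall>z. (Var z \<^bold>\<in> Var y \<^bold>\<longleftrightarrow> Var z \<^bold>\<in> Var x \<^bold>\<or> Var z \<^bold>\<approx> Var x))"
      unfolding forces_simps(3,6)
    proof (intro ballI conjI forces_ImpI)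
      fix v s assume s: "s \<le> r" "forces s (?e'(z := v)) (Var z \<^bold>\<in> Var y)"
      have eq: "s \<le> eqv (check t) u" using s(1) r by (rule order_trans)
      have "s \<le> sup (eqv (check t) v) (mem v (check t))" using s(2) assms by (simp add: mem_t')
      then have "s \<le> sup (mem v u) (eqv v u)"
      proof (rule le_supE)
        fix s' assume "s' \<le> s" "s' \<le> eqv (check t) v"
        then show "s' \<le> sup (mem v u) (eqv v u)"
          using eq by (meson eqv_sym eqv_trans le_supI2 order_trans)
      next
        fix s' assume "s' \<le> s" "s' \<le> mem v (check t)"
        then show "s' \<le> sup (mem v u) (eqv v u)"
          using eq by (meson mem_eqv_right le_supI1 order_trans)
      qed
      then show "forces s (?e'(z := v)) (Var z \<^bold>\<in> Var x \<^bold>\<or> Var z \<^bold>\<approx> Var x)"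
        using assms by (simp add: forces_def mem_def eqv_def)
    next
      fix v s assume s: "s \<le> r" "forces s (?e'(z := v)) (Var z \<^bold>\<in> Var x \<^bold>\<or> Var z \<^bold>\<approx> Var x)"
      have eq: "s \<le> eqv (check t) u" using s(1) r by (rule order_trans)
      from s(2) have "s \<le> mem v (check t')"
      proof (rule forces_OrE)
        fix s' assume "s' \<le> s" "forces s' (?e'(z := v)) (Var z \<^bold>\<in> Var x)"
        then have "s' \<le> eqv u (check t)" "s' \<le> mem v u"
          using eq assms by (auto intro: eqv_sym order_trans)
        then show "s' \<le> mem v (check t')" unfolding mem_t' by (meson mem_eqv_right le_supI2)
      next
        fix s' assume "s' \<le> s" "forces s' (?e'(z := v)) (Var z \<^bold>\<approx> Var x)"
        then have "s' \<le> eqv (check t) u" "s' \<le> eqv v u"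
          using eq assms by (auto intro: order_trans)
        then show "s' \<le> mem v (check t')" unfolding mem_t' by (meson eqv_sym eqv_trans le_supI1)
      qed
      then show "forces s (?e'(z := v)) (Var z \<^bold>\<in> Var y)" using assms by simp
    qed
    moreover have "forces r ?e' (Var y \<^bold>\<in> Var a)" using mem_I[OF t'(1)] assms by simp
    ultimately show "forces r (?e(x := u)) ?successor"
      by (intro forces_ExI[OF check_in_V[of t']]) (simp only: forces_simps(3))
  qed
  then have "forces top ?e (\<^bold>\<forall>x. (Var x \<^bold>\<in> Var a \<^bold>\<longrightarrow> ?successor))"
    using assms by (intro forces_AllI forces_ImpI) simp
  with zero show "forces top e (\<^bold>\<exists>a. (?zero \<^bold>\<and> (\<^bold>\<forall>x. (Var x \<^bold>\<in> Var a \<^bold>\<longrightarrow> ?successor))))"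
    by (intro forces_ExI[OF check_in_V[of I]]) (simp only: forces_simps(3))
qed

text \<open>
  Here \<open>f u d\<close> is the truth value of ``\<open>d\<close> is the first element of \<open>D\<close> that
  belongs to \<open>u\<close>'', for a well-order of the universe. It is extensional in \<open>u\<close> but not
  in \<open>d\<close>, as names that are equal in the model may be far apart in the well-order; hence
  uniqueness concerns the names themselves. That some \<open>d\<close> is selected as soon as \<open>u\<close> meets
  \<open>D\<close> is well-founded induction.
\<close>

lemma selector:
  obtains f :: "'v \<Rightarrow> 'v \<Rightarrow> 'a" where
    "\<And>p u v d. p \<le> eqv u v \<Longrightarrow> p \<le> f u d \<Longrightarrow> p \<le> f v d"
    "\<And>p u d. p \<le> f u d \<Longrightarrow> p \<le> mem d u"
    "\<And>p u d d'. d \<in> D \<Longrightarrow> d' \<in> D \<Longrightarrow> d \<noteq> d' \<Longrightarrow> p \<le> f u d \<Longrightarrow> p \<le> f u d' \<Longrightarrow> p = bot"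
    "\<And>p u d. d \<in> D \<Longrightarrow> p \<le> mem d u \<Longrightarrow> p \<le> (SUP d\<in>D. f u d)"
proof -
  obtain R :: "'v rel" where "Well_order R \<and> Field R = UNIV" using well_ordering ..
  then have R: "Well_order R" "Field R = UNIV" by auto
  define L where "L = R - Id"
  have wf: "wf L" using R(1) by (simp add: L_def well_order_on_def)
  have total: "d \<noteq> d' \<Longrightarrow> (d, d') \<in> L \<or> (d', d) \<in> L" for d d'
    using R by (auto simp: L_def well_order_on_def linear_order_on_def total_on_def)
  define f where "f u d = inf (mem d u) (INF d'\<in>{d'\<in>D. (d', d) \<in> L}. - mem d' u)" for u d
  have f_iff: "p \<le> f u d \<longleftrightarrow>
      p \<le> mem d u \<and> (\<forall>d'\<in>D. (d', d) \<in> L \<longrightarrow> (\<forall>q\<le>p. q \<le> mem d' u \<longrightarrow> q = bot))" for p u d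
    by (auto simp: f_def le_INF_iff le_uminus_iff)
  have f_eqv: "p \<le> f v d" if "p \<le> eqv u v" "p \<le> f u d" for p u v d
    unfolding f_iff
  proof (intro conjI ballI impI allI)
    show "p \<le> mem d v" using that by (auto simp: f_iff intro: mem_eqv_right)
  next
    fix d' q assume "d' \<in> D" "(d', d) \<in> L" and q: "q \<le> p" "q \<le> mem d' v"
    moreover have "q \<le> mem d' u" using q that(1) by (meson eqv_sym mem_eqv_right order_trans)
    ultimately show "q = bot" using that(2) by (auto simp: f_iff)
  qed
  have f_unique: "p = bot" if "d \<in> D" "d' \<in> D" "d \<noteq> d'" "p \<le> f u d" "p \<le> f u d'" for p u d d'
    using that total[of d d'] by (auto simp: f_iff)
  have f_cover: "p \<le> (SUP d\<in>D. f u d)" if "d \<in> D" "p \<le> mem d u" for p u d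
    using wf that
  proof (induction d arbitrary: p rule: wf_induct_rule)
    case (less d)
    let ?smaller = "SUP d'\<in>{d'\<in>D. (d', d) \<in> L}. mem d' u"
    \<comment> \<open>Below \<open>- ?smaller\<close> the element \<open>d\<close> itself is the first one.\<close>
    show ?case
    proof (rule le_cases[where a = ?smaller])
      fix q assume "q \<le> ?smaller"
      then show "q \<le> (SUP d\<in>D. f u d)" by (rule le_SUP_E) (use less.IH in auto)
    next
      fix q assume q: "q \<le> p" "q \<le> - ?smaller"
      have "r = bot" if "d' \<in> D" "(d', d) \<in> L" "r \<le> q" "r \<le> mem d' u" for d' r
      proof -
        have "r \<le> ?smaller" by (rule le_SUP_I[of d']) (use that in auto)
        then show ?thesis using q(2) that(3) by (simp add: le_uminus_iff)
      qed
      moreover have "q \<le> mem d u" using q(1) less.prems(2) by (rule order_trans)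
      ultimately have "q \<le> f u d" by (auto simp: f_iff)
      with less.prems(1) show "q \<le> (SUP d\<in>D. f u d)" by (rule le_SUP_I)
    qed
  qed
  have f_mem: "p \<le> mem d u" if "p \<le> f u d" for p u d using that by (simp add: f_iff)
  show thesis using that[of f] f_eqv f_mem f_unique f_cover by blast
qed

text \<open>
  Each element of a member of \<open>A\<close> is equal to a name in the set \<open>D\<close>, so the selector of
  \<open>D\<close> picks an element from each nonempty member. The choice set collects these \<open>d\<close>,
  weighted by the truth value of ``\<open>d\<close> is selected from some \<open>u\<close> in \<open>A\<close>''.
  Disjointness makes the selections from different members agree whenever they meet the same member.
\<close>

lemma valid_choice:
  assumes dist: "distinct [a, c, x, y, z, w]"
  shows "valid code (\<^bold>\<forall>a.
      ((\<^bold>\<forall>x. (Var x \<^bold>\<in> Var a \<^bold>\<longrightarrow> (\<^bold>\<exists>y. Var y \<^bold>\<in> Var x))) \<^bold>\<and>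
       (\<^bold>\<forall>x. \<^bold>\<forall>y. (Var x \<^bold>\<in> Var a \<^bold>\<and> Var y \<^bold>\<in> Var a \<^bold>\<and> (\<^bold>\<exists>z. (Var z \<^bold>\<in> Var x \<^bold>\<and> Var z \<^bold>\<in> Var y)) \<^bold>\<longrightarrow>
          Var x \<^bold>\<approx> Var y)) \<^bold>\<longrightarrow>
       (\<^bold>\<exists>c. \<^bold>\<forall>x. (Var x \<^bold>\<in> Var a \<^bold>\<longrightarrow> Ex1 w y (Var y \<^bold>\<in> Var x \<^bold>\<and> Var y \<^bold>\<in> Var c)))))"
    (is "valid code (\<^bold>\<forall>a. (?nonempty \<^bold>\<and> ?disjoint \<^bold>\<longrightarrow> ?choice))")
proof (rule validI, intro forces_AllI forces_ImpI)
  fix e A p assume A: "A \<in> V" and hyp: "forces p (e(a := A)) (?nonempty \<^bold>\<and> ?disjoint)"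
  have nonempty: "forces q (e(a := A, x := u)) (\<^bold>\<exists>y. Var y \<^bold>\<in> Var x)"
    if "u \<in> V" "q \<le> p" "q \<le> mem u A" for q u
    using hyp dist that by simp
  have disjoint: "q \<le> eqv u v"
    if "u \<in> V" "v \<in> V" "q \<le> p" "q \<le> mem u A" "q \<le> mem v A" "t \<in> V" "q \<le> mem t u" "q \<le> mem t v"
    for q u v t
  proof -
    have "forces q (e(a := A, x := u, y := v)) (\<^bold>\<exists>z. (Var z \<^bold>\<in> Var x \<^bold>\<and> Var z \<^bold>\<in> Var y))"
      using dist that by (intro forces_ExI[of t]) auto
    then show ?thesis using hyp dist that by simp
  qed
  define D where "D = (\<Union>u\<in>vdom A. vdom u)"
  have D: "small D" "D \<subseteq> V"
    using A by (auto simp: D_def intro!: small_UN small_vdom intro: vdom_in_V)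
  obtain f where
    f_eqv: "\<And>p u v d. p \<le> eqv u v \<Longrightarrow> p \<le> f u d \<Longrightarrow> p \<le> f v d" and
    f_mem: "\<And>p u d. p \<le> f u d \<Longrightarrow> p \<le> mem d u" and
    f_unique: "\<And>p u d d'. d \<in> D \<Longrightarrow> d' \<in> D \<Longrightarrow> d \<noteq> d' \<Longrightarrow> p \<le> f u d \<Longrightarrow> p \<le> f u d' \<Longrightarrow> p = bot" and
    f_cover: "\<And>p u d. d \<in> D \<Longrightarrow> p \<le> mem d u \<Longrightarrow> p \<le> (SUP d\<in>D. f u d)"
    by (rule selector[of D]) blast
  define g where "g d = (SUP u\<in>V. inf (mem u A) (f u d))" for d
  define c' where "c' = name D g"
  have "c' \<in> V" unfolding c'_def using D by (rule name_in_V)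
  have mem_c': "mem t c' = (SUP d\<in>D. inf (g d) (eqv d t))" for t
    unfolding c'_def using D(1) by (rule mem_name)
  have "q \<le> (SUP d\<in>D. f u d)" if u: "u \<in> V" "q \<le> p" "q \<le> mem u A" for q u
    using nonempty[OF u]
  proof (rule forces_ExE)
    fix t r assume r: "r \<le> q" "forces r (e(a := A, x := u, y := t)) (Var y \<^bold>\<in> Var x)"
    then have t: "r \<le> mem t u" using dist by simp
    have "r \<le> mem u A" using r(1) u(3) by (rule order_trans)
    then show "r \<le> (SUP d\<in>D. f u d)"
    proof (rule memE)
      fix u' s assume u': "u' \<in> vdom A" "s \<le> r" "s \<le> eqv u' u"
      have "s \<le> mem t u'" using u' t by (meson eqv_sym mem_eqv_right order_trans)
      then show "s \<le> (SUP d\<in>D. f u d)"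
      proof (rule memE)
        fix d s' assume d: "d \<in> vdom u'" "s' \<le> s" "s' \<le> mem d u'"
        have "s' \<le> mem d u" using d u' by (meson mem_eqv_right order_trans)
        moreover have "d \<in> D" using d(1) u'(1) by (auto simp: D_def)
        ultimately show "s' \<le> (SUP d\<in>D. f u d)" by (intro f_cover)
      qed
    qed
  qed
  note selected = this
  have "forces q (e(a := A, c := c', x := u)) (Ex1 w y (Var y \<^bold>\<in> Var x \<^bold>\<and> Var y \<^bold>\<in> Var c))"
    if u: "u \<in> V" "q \<le> p" "q \<le> mem u A" for q u
    using selected[OF u]
  proof (rule forces_by_SUP)
    fix d r assume d: "d \<in> D" "r \<le> q" "r \<le> f u d"
    have unique: "s \<le> eqv t d" if t: "t \<in> V" "s \<le> r" "s \<le> mem t u" "s \<le> mem t c'" for s t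
      using t(4) unfolding mem_c'
    proof (rule le_SUP_E)
      fix d' s' assume d': "d' \<in> D" "s' \<le> s" "s' \<le> inf (g d') (eqv d' t)"
      then have "s' \<le> (SUP v\<in>V. inf (mem v A) (f v d'))" by (simp add: g_def)
      then show "s' \<le> eqv t d"
      proof (rule le_SUP_E)
        fix v s'' assume v: "v \<in> V" "s'' \<le> s'" "s'' \<le> inf (mem v A) (f v d')"
        have le: "s'' \<le> eqv d' t" "s'' \<le> mem t u" "s'' \<le> f u d" "s'' \<le> mem u A" "s'' \<le> p"
          using v(2) d'(2,3) t(2,3) d(2,3) u(2,3) by (auto intro: order_trans)
        have "s'' \<le> mem d' u" using le(1,2) by (meson eqv_sym mem_eqv_left)
        \<comment> \<open>The name \<open>d'\<close> lies in both members \<open>v\<close> and \<open>u\<close>, which therefore coincide, so that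
            \<open>d'\<close> is selected from \<open>u\<close> just as \<open>d\<close> is.\<close>
        moreover have "s'' \<le> mem d' v" using v(3) by (auto intro: f_mem)
        ultimately have "s'' \<le> eqv v u"
          using v(1,3) u(1) le(4,5) d'(1) D(2) by (intro disjoint[of v u s'' d']) auto
        then have "s'' \<le> f u d'" using v(3) by (auto intro: f_eqv)
        then show "s'' \<le> eqv t d"
          using f_unique[OF d(1) d'(1) _ le(3)] le(1) by (cases "d = d'") (auto intro: eqv_sym)
      qed
    qed
    have "r \<le> g d" unfolding g_def
      using u d(2,3) by (intro le_SUP_I[of u]) (auto intro: order_trans)
    then have "r \<le> mem d c'" unfolding mem_c' using d(1) by (intro le_SUP_I[of d]) auto
    then have both: "s \<le> mem t u" "s \<le> mem t c'" if "s \<le> r" "s \<le> eqv t d" for s t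
      using that f_mem[OF d(3)] by (meson eqv_sym mem_eqv_left order_trans)+
    let ?e = "e(a := A, c := c', x := u, w := d)"
    have "forces r ?e (\<^bold>\<forall>y. ((Var y \<^bold>\<in> Var x \<^bold>\<and> Var y \<^bold>\<in> Var c) \<^bold>\<longleftrightarrow> Var y \<^bold>\<approx> Var w))"
      unfolding forces_simps(3,6)
    proof (intro ballI conjI forces_ImpI)
      fix t s assume "t \<in> V" "s \<le> r" "forces s (?e(y := t)) (Var y \<^bold>\<in> Var x \<^bold>\<and> Var y \<^bold>\<in> Var c)"
      then show "forces s (?e(y := t)) (Var y \<^bold>\<approx> Var w)" using dist unique[of t s] by auto
    next
      fix t s assume "s \<le> r" "forces s (?e(y := t)) (Var y \<^bold>\<approx> Var w)"
      then show "forces s (?e(y := t)) (Var y \<^bold>\<in> Var x \<^bold>\<and> Var y \<^bold>\<in> Var c)"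
        using dist both[of s t] by auto
    qed
    moreover have "d \<in> V" using d(1) D(2) by auto
    ultimately show "forces r (e(a := A, c := c', x := u)) (Ex1 w y (Var y \<^bold>\<in> Var x \<^bold>\<and> Var y \<^bold>\<in> Var c))"
      by (rule forces_ExI[rotated])
  qed
  then have "forces p (e(a := A, c := c')) (\<^bold>\<forall>x. (Var x \<^bold>\<in> Var a \<^bold>\<longrightarrow> Ex1 w y (Var y \<^bold>\<in> Var x \<^bold>\<and> Var y \<^bold>\<in> Var c)))"
    using dist by (intro forces_AllI forces_ImpI) simp
  with \<open>c' \<in> V\<close> show "forces p (e(a := A)) ?choice" by (rule forces_ExI)
qed

lemma zfc_axiom_valid: "zfc_axiom C \<phi> \<Longrightarrow> valid code \<phi>"
  by (induction rule: zfc_axiom.induct)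
     (fact valid_extensionality valid_foundation valid_separation valid_pairing valid_union
        valid_powerset valid_infinity valid_replacement valid_choice)+


section \<open>Soundness of the calculus\<close>

lemma valid_impI:
  assumes "\<And>e p. (\<And>x. e x \<in> V) \<Longrightarrow> forces p e \<phi> \<Longrightarrow> forces p e \<psi>"
  shows "valid code (\<phi> \<^bold>\<longrightarrow> \<psi>)"
  by (rule validI) (auto intro: assms)

lemma val_trm_in_V: "(\<And>x. e x \<in> V) \<Longrightarrow> trm_lang V t \<Longrightarrow> val_trm e t \<in> V"
  by (cases t) auto

text \<open>
  The clauses for \<open>forces\<close> validate intuitionistic logic, and \<open>- (- a) = a\<close> in the algebra
  makes it classical. The quantifier rules use that the value of a formula depends only on its free
  variables, and that constants and variables denote elements of \<open>V\<close>.
\<close>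

lemma zfc_theorem_valid: "zfc_theorem V \<phi> \<Longrightarrow> valid code \<phi>"
proof (induction rule: zfc_theorem.induct)
  case (zfc \<phi>)
  then show ?case by (rule zfc_axiom_valid)
next
  case (imp_weaken \<phi> \<psi>)
  show ?case by (rule valid_impI) (auto intro: forces_mono)
next
  case (imp_distrib \<phi> \<psi> \<chi>)
  show ?case by (rule valid_impI) (simp, meson order_trans order_refl)
next
  case (and_elim1 \<phi> \<psi>)
  show ?case by (rule valid_impI) simp
next
  case (and_elim2 \<phi> \<psi>)
  show ?case by (rule valid_impI) simp
next
  case (and_intro \<phi> \<psi>)
  show ?case by (rule valid_impI) (auto intro: forces_mono)
next
  case (or_intro1 \<phi> \<psi>)
  show ?case by (rule valid_impI) (simp add: forces_OrI)
next
  case (or_intro2 \<phi> \<psi>)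
  show ?case by (rule valid_impI) (simp add: forces_OrI)
next
  case (or_elim \<phi> \<psi> \<chi>)
  show ?case
  proof (intro valid_impI forces_ImpI)
    fix e p q r assume "forces p e (\<phi> \<^bold>\<longrightarrow> \<chi>)" "q \<le> p" "forces q e (\<psi> \<^bold>\<longrightarrow> \<chi>)" "r \<le> q"
      "forces r e (\<phi> \<^bold>\<or> \<psi>)"
    note hyps = this
    from hyps(5) show "forces r e \<chi>"
    proof (rule forces_by_Or)
      fix s assume "s \<le> r" "forces s e \<phi>"
      with hyps show "forces s e \<chi>" by (meson forces_simps(4) order_trans)
    next
      fix s assume "s \<le> r" "forces s e \<psi>"
      with hyps show "forces s e \<chi>" by (meson forces_simps(4) order_trans)
    qed
  qed
next
  case (not_intro \<phi> \<psi>)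
  show ?case
  proof (intro valid_impI forces_ImpI)
    fix e p q assume "forces p e (\<phi> \<^bold>\<longrightarrow> \<psi>)" "q \<le> p" "forces q e (\<phi> \<^bold>\<longrightarrow> \<^bold>\<sim> \<psi>)"
    then have "forces r e \<psi> \<and> forces r e (\<^bold>\<sim> \<psi>)" if "r \<le> q" "forces r e \<phi>" for r
      using that by (meson forces_simps(4) order_trans)
    then show "forces q e (\<^bold>\<sim> \<phi>)" by auto
  qed
next
  case (not_not \<phi>)
  show ?case by (rule valid_impI) (simp add: forces_def)
next
  case (all_elim \<phi> t x)
  show ?case by (rule valid_impI) (use all_elim val_trm_in_V in \<open>simp add: forces_subst\<close>)
next
  case (ex_intro \<phi> t x)
  show ?case
  proof (rule valid_impI)
    fix e p assume "\<And>x. e x \<in> V" "forces p e (subst x t \<phi>)"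
    then show "forces p e (\<^bold>\<exists>x. \<phi>)"
      using ex_intro by (intro forces_ExI[of "val_trm e t"]) (auto simp: forces_subst val_trm_in_V)
  qed
next
  case (eq_refl t)
  show ?case by (rule validI) simp
next
  case (eq_subst \<phi> s t x)
  show ?case
  proof (intro valid_impI forces_ImpI)
    fix e p q assume "forces p e (s \<^bold>\<approx> t)" "q \<le> p" "forces q e (subst x s \<phi>)"
    then have "q \<le> eqv (val_trm e s) (val_trm e t)" "forces q (e(x := val_trm e s)) \<phi>"
      using eq_subst by (auto simp: forces_subst)
    then have "forces q (e(x := val_trm e t)) \<phi>"
      using forces_eqv[OF eq_subst(1), of q "e(x := val_trm e s)" "e(x := val_trm e t)"] by auto
    then show "forces q e (subst x t \<phi>)" using eq_subst by (simp add: forces_subst)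
  qed
next
  case (modus_ponens \<phi> \<psi>)
  show ?case
  proof (rule validI)
    fix e :: "nat \<Rightarrow> 'v" assume "\<And>x. e x \<in> V"
    then have "forces top e (\<phi> \<^bold>\<longrightarrow> \<psi>)" "forces top e \<phi>"
      by (rule valid_forces[OF modus_ponens.IH(1)], rule valid_forces[OF modus_ponens.IH(2)])
    then show "forces top e \<psi>" by simp
  qed
next
  case (all_intro \<psi> \<phi> x)
  show ?case
  proof (rule valid_impI)
    fix e :: "nat \<Rightarrow> 'v" and p assume e: "\<And>x. e x \<in> V" and p: "forces p e \<psi>"
    show "forces p e (\<^bold>\<forall>x. \<phi>)"
    proof (rule forces_AllI)
      fix u assume "u \<in> V"
      then have "forces p (e(x := u)) (\<psi> \<^bold>\<longrightarrow> \<phi>)" using e by (intro valid_forces[OF all_intro.IH]) auto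
      moreover have "forces p (e(x := u)) \<psi>"
        using p all_intro.hyps by (subst forces_cong[where e' = e]) auto
      ultimately show "forces p (e(x := u)) \<phi>" by simp
    qed
  qed
next
  case (ex_elim \<phi> \<psi> x)
  show ?case
  proof (rule valid_impI)
    fix e :: "nat \<Rightarrow> 'v" and p assume e: "\<And>x. e x \<in> V" and "forces p e (\<^bold>\<exists>x. \<phi>)"
    from this(2) show "forces p e \<psi>"
    proof (rule forces_by_Ex)
      fix u q assume "u \<in> V" and q: "forces q (e(x := u)) \<phi>"
      then have "forces q (e(x := u)) (\<phi> \<^bold>\<longrightarrow> \<psi>)" using e by (intro valid_forces[OF ex_elim.IH]) auto
      with q have "forces q (e(x := u)) \<psi>" by simp
      then show "forces q e \<psi>"
        using ex_elim.hyps by (subst forces_cong[where e' = "e(x := u)"]) auto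
    qed
  qed
qed

end

theorem theorem8p21:
  fixes code :: "'a::{complete_lattice, boolean_algebra} \<Rightarrow> 'v::zfc_universe"
  assumes "inj code" and "\<exists>A. elts A = range code"
  shows "(\<forall>\<phi>. zfc_axiom (V_twist code) \<phi> \<longrightarrow> valid code \<phi>) \<and>
         (\<forall>\<phi>. zfc_theorem (V_twist code) \<phi> \<longrightarrow> valid code \<phi>)"
proof -
  interpret twist_model code using assms by unfold_locales (auto simp: small_def)
  show ?thesis using zfc_axiom_valid zfc_theorem_valid by blast
qed

end
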